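(* Let $t$ be a positive integer. (i) If $t\equiv 0\pmod 3$ and $\frac{4t}{3}+1$ is a prime power, then $r'_2(K_{2,t})=CR(K_{2,t},K_3)=\frac{4t}{3}+2$. (ii) If $t$ is even and $2t+1$ is a prime power, then $r'_2(K_{3,t})=CR(K_{3,t},K_3)=2t+2$.
   Context: An edge-colored graph $G$ on $p$ vertices with edge-coloring $\chi$ is called orderable if there exist an ordering $(v_1,\ldots,v_p)$ of $V(G)$ and a list $(c_1,\ldots,c_{p-1})$ of not necessarily distinct colors such that for every edge $v_iv_j\in E(G)$ with $i<j$ we have $\chi(v_iv_j)=c_i$. An edge-colored graph is rainbow if all its edges have pairwise different colors. For a graph $G$, $r'_2(G)$ is the minimum integer $n$ such that every 2-edge-coloring of $K_n$ (each edge gets one of two given colors) contains an orderable copy of $G$. For graphs $G,H$, $CR(G,H)$ is the minimum integer $n$ such that every edge-coloring of $K_n$ with any number of colors contains either an orderable copy of $G$ or a rainbow copy of $H$. Copies are (not necessarily induced) subgraphs with the inherited coloring. *)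

theory Defs
  imports "HOL-Number_Theory.Number_Theory"
begin

(* An edge is the set of its two endpoints. *)
record 'v graph =
  verts :: "'v set"
  edges :: "'v set set"

definition subgraph :: "'v graph \<Rightarrow> 'v graph \<Rightarrow> bool" where
  "subgraph H K \<longleftrightarrow> verts H \<subseteq> verts K \<and> edges H \<subseteq> edges K"

definition graph_iso :: "'v graph \<Rightarrow> 'w graph \<Rightarrow> bool" where
  "graph_iso G H \<longleftrightarrow>
     (\<exists>f. bij_betw f (verts G) (verts H) \<and> edges H = (\<lambda>e. f ` e) ` edges G)"

definition copy_in :: "'w graph \<Rightarrow> 'v graph \<Rightarrow> 'w graph \<Rightarrow> bool" where
  "copy_in K G H \<longleftrightarrow> subgraph H K \<and> graph_iso G H"

definition complete_graph :: "nat \<Rightarrow> nat graph" where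
  "complete_graph n = \<lparr>verts = {..<n}, edges = {{u, v} |u v. u < n \<and> v < n \<and> u \<noteq> v}\<rparr>"

definition complete_bipartite :: "nat \<Rightarrow> nat \<Rightarrow> (nat + nat) graph" where
  "complete_bipartite s t =
     \<lparr>verts = {..<s} <+> {..<t}, edges = {{Inl i, Inr j} |i j. i < s \<and> j < t}\<rparr>"

(* An edge-coloring is given as a function on all vertex sets; only its values on
   the edges of the graph matter. Lists are indexed from 0. *)
definition orderable :: "'v graph \<Rightarrow> ('v set \<Rightarrow> 'c) \<Rightarrow> bool" where
  "orderable G \<chi> \<longleftrightarrow>
     (\<exists>vs cs. distinct vs \<and> set vs = verts G \<and> length cs = length vs - 1 \<and>
        (\<forall>i j. i < j \<and> j < length vs \<and> {vs ! i, vs ! j} \<in> edges G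
           \<longrightarrow> \<chi> {vs ! i, vs ! j} = cs ! i))"

definition rainbow :: "'v graph \<Rightarrow> ('v set \<Rightarrow> 'c) \<Rightarrow> bool" where
  "rainbow G \<chi> \<longleftrightarrow> inj_on \<chi> (edges G)"

definition r2' :: "'v graph \<Rightarrow> nat" where
  "r2' G = (LEAST n. \<forall>\<chi> :: nat set \<Rightarrow> nat. \<chi> ` edges (complete_graph n) \<subseteq> {0, 1} \<longrightarrow>
     (\<exists>G'. copy_in (complete_graph n) G G' \<and> orderable G' \<chi>))"

(* Since complete_graph n has finitely many edges, natural numbers suffice as colors
   to represent edge-colorings with any number of colors. *)
definition CR :: "'v graph \<Rightarrow> 'w graph \<Rightarrow> nat" where
  "CR G H = (LEAST n. \<forall>\<chi> :: nat set \<Rightarrow> nat.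
     (\<exists>G'. copy_in (complete_graph n) G G' \<and> orderable G' \<chi>) \<or>
     (\<exists>H'. copy_in (complete_graph n) H H' \<and> rainbow H' \<chi>))"

end

theory Submission
  imports Defs "HOL-Algebra.Algebraic_Closure"
begin

text \<open>
  Fix the ordered small side of \<open>K\<^bsub>2,t\<^esub>\<close> or \<open>K\<^bsub>3,t\<^esub>\<close> and the colours
  assigned to its vertices. Whether a further vertex can join the large side is decided by its edges
  to the small side alone, so an orderable copy exists iff few vertices are bad for some choice.

  Upper bound: a colouring without rainbow triangles uses at most two colours or has a proper
  module with at least two vertices (Gallai), and vertices outside a module are never bad for pairs
  or triples inside it. For two colours, the average over all pairs (triples) is small enough.

  Lower bound: in the Paley colouring of the field with \<open>4 s + 1\<close> elements, exactly \<open>s\<close>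
  vertices see a given pair in a given two-coloured pattern, because the quadratic character
  \<open>\<eta>\<close> satisfies \<open>\<Sum>b. \<eta> b * \<eta> (b + d) = -1\<close> for \<open>d \<noteq> 0\<close>. The field is
  realised as the set of roots of \<open>x\<^bsup>4s+1\<^esup> = x\<close> in an algebraically closed field.
\<close>

section \<open>Colourings without rainbow triangles\<close>

text \<open>Let \<open>N\<close> be the number of vertices. For pairs the average number of bad
  vertices is at most \<open>(N - 1) / 4\<close>, so for \<open>N = 4 * s + 2\<close> some pair has
  at most \<open>s\<close> of them, while on \<open>4 * s + 1\<close> vertices the Paley colouring
  forces at least \<open>s\<close> for every pair. Triples are off by one at first sight. A vertex
  is bad because of the first two or the last two vertices of the triple, and adding both averages
  gives \<open>(N - 1) / 2\<close>, whereas \<open>(N - 3) / 2\<close> is required. The difference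
  comes from the triple itself: its third vertex may be counted for the other two, yet it cannot
  join the large side. Discounting it pushes the average below \<open>(N - 2) / 2\<close>, which
  suffices by integrality. The same discount appears in the lower bound, where two disjoint sets of
  size \<open>s\<close> lose at most one vertex in total, so \<open>2 * s - 1\<close> bad vertices
  remain. Constant colour assignments \<open>\<kappa>\<close> suffice for the upper bound; the lower
  bound has to defeat every \<open>\<kappa>\<close>.\<close>

text \<open>
  Here \<open>f\<close> gives the colours of the edges from a vertex \<open>b\<close> to the ordered small side
  \<open>xs\<close>, and \<open>\<kappa>\<close> the colours assigned to the vertices of \<open>xs\<close>. The first disjunct inserts
  \<open>b\<close> before \<open>x\<close> (its edges onwards share the colour assigned to \<open>b\<close>), the second one after \<open>x\<close>.
\<close>

fun fits :: "('a \<Rightarrow> 'c) \<Rightarrow> ('a \<Rightarrow> 'c) \<Rightarrow> 'a list \<Rightarrow> bool" where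
  "fits \<kappa> f [] \<longleftrightarrow> True"
| "fits \<kappa> f (x # xs) \<longleftrightarrow> (\<forall>y\<in>set xs. f y = f x) \<or> (f x = \<kappa> x \<and> fits \<kappa> f xs)"

lemma fits_constant: "(\<And>x y. x \<in> set xs \<Longrightarrow> y \<in> set xs \<Longrightarrow> f x = f y) \<Longrightarrow> fits \<kappa> f xs"
  by (cases xs) auto

definition gallai :: "('a \<Rightarrow> 'a \<Rightarrow> 'c) \<Rightarrow> 'a set \<Rightarrow> bool" where
  "gallai c V \<longleftrightarrow> (\<forall>x\<in>V. \<forall>y\<in>V. \<forall>z\<in>V. x \<noteq> y \<and> y \<noteq> z \<and> x \<noteq> z \<longrightarrow>
     c x y = c y z \<or> c y z = c x z \<or> c x y = c x z)"

definition bad :: "('a \<Rightarrow> 'a \<Rightarrow> 'c) \<Rightarrow> 'a set \<Rightarrow> ('a \<Rightarrow> 'c) \<Rightarrow> 'a list \<Rightarrow> 'a set" where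
  "bad c V \<kappa> xs = {b \<in> V - set xs. \<not> fits \<kappa> (c b) xs}"

lemma at_most_two_elements:
  assumes "\<not> (\<exists>p q r. p \<in> U \<and> q \<in> U \<and> r \<in> U \<and> p \<noteq> q \<and> p \<noteq> r \<and> q \<noteq> r)"
  shows "\<exists>p q. \<forall>t\<in>U. t = p \<or> t = q"
proof (cases "\<exists>p q. p \<in> U \<and> q \<in> U \<and> p \<noteq> q")
  case True
  then show ?thesis using assms by blast
next
  case False
  then show ?thesis by blast
qed

lemma gallai_subset: "gallai c V \<Longrightarrow> W \<subseteq> V \<Longrightarrow> gallai c W"
  unfolding gallai_def by blast

lemma four_mult_le_power2: "4 * (m * n) \<le> (m + n)^2" for m n :: nat
proof -
  have "0 \<le> (int m - int n)^2" by simp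
  then have "int (4 * (m * n)) \<le> int ((m + n)^2)" by (simp add: power2_eq_square algebra_simps)
  then show ?thesis by linarith
qed

text \<open>Each element of \<open>B\<close> is missing from exactly one summand, the one where
  \<open>z\<close> is that element.\<close>

lemma sum_card_remove:
  assumes "finite A" "B \<subseteq> A"
  shows "(\<Sum>z\<in>A. card (B - {z})) = (card A - 1) * card B"
proof -
  have fB: "finite B" using assms finite_subset by blast
  have "(\<Sum>z\<in>A. card (B - {z})) + card B = (\<Sum>z\<in>A. card (B - {z})) + (\<Sum>z\<in>A. of_bool (z \<in> B))"
    using assms by (simp add: Int_absorb1)
  also have "\<dots> = (\<Sum>z\<in>A. card (B - {z}) + of_bool (z \<in> B))" by (simp add: sum.distrib)
  also have "\<dots> = (\<Sum>z\<in>A. card B)"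
  proof (rule sum.cong)
    fix z
    show "card (B - {z}) + of_bool (z \<in> B) = card B"
      using card.remove[OF fB, of z] by (cases "z \<in> B") auto
  qed simp
  finally show ?thesis by (simp add: diff_mult_distrib)
qed

section \<open>Components of one colour and modules\<close>

locale symmetric_colouring =
  fixes c :: "'a \<Rightarrow> 'a \<Rightarrow> 'c"
  assumes sym: "c x y = c y x"
begin

text \<open>These are the unions of connected components of the graph of \<open>p\<close>-coloured
  edges on \<open>V\<close>. Working with cuts instead of paths lets the triangle condition be
  applied to one crossing edge.\<close>

definition separated :: "'c \<Rightarrow> 'a set \<Rightarrow> 'a set \<Rightarrow> bool" where
  "separated p V S \<longleftrightarrow> S \<subseteq> V \<and> (\<forall>x\<in>S. \<forall>y\<in>V - S. c x y \<noteq> p)"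

text \<open>For \<open>u\<close> outside \<open>V\<close> no separated set contains \<open>u\<close>
  and the intersection is the whole type; facts placing the component inside \<open>V\<close>
  therefore assume \<open>u \<in> V\<close>.\<close>

definition component :: "'c \<Rightarrow> 'a set \<Rightarrow> 'a \<Rightarrow> 'a set" where
  "component p V u = \<Inter>{S. separated p V S \<and> u \<in> S}"

definition connected_in :: "'c \<Rightarrow> 'a set \<Rightarrow> bool" where
  "connected_in p V \<longleftrightarrow> (\<forall>S. separated p V S \<longrightarrow> S = {} \<or> S = V)"

lemma separated_complement: "separated p V S \<Longrightarrow> separated p V (V - S)"
  unfolding separated_def using sym by (metis Diff_iff Diff_subset)

lemma component_minimal: "separated p V S \<Longrightarrow> u \<in> S \<Longrightarrow> component p V u \<subseteq> S"
  unfolding component_def by blast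

lemma component_self: "u \<in> component p V u"
  unfolding component_def by blast

lemma component_separated:
  assumes "u \<in> V"
  shows "separated p V (component p V u)"
proof -
  have "separated p V V" unfolding separated_def by simp
  then have "component p V u \<subseteq> V" using assms component_minimal by blast
  moreover have "c x y \<noteq> p" if x: "x \<in> component p V u" and y: "y \<in> V - component p V u" for x y
  proof -
    obtain S where "separated p V S" "u \<in> S" "y \<notin> S" using y unfolding component_def by blast
    then show ?thesis using x y unfolding component_def separated_def by blast
  qed
  ultimately show ?thesis unfolding separated_def by blast
qed

lemma connected_inE:
  assumes "connected_in p V" "S \<subseteq> V" "S \<noteq> {}" "S \<noteq> V"
  obtains x y where "x \<in> S" "y \<in> V - S" "c x y = p"
  using assms unfolding connected_in_def separated_def by blast

lemma component_proper:
  assumes "\<not> connected_in p V" "u \<in> V"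
  shows "component p V u \<noteq> V"
proof -
  obtain S where S: "separated p V S" "S \<noteq> {}" "S \<noteq> V"
    using assms unfolding connected_in_def by blast
  show ?thesis
  proof (cases "u \<in> S")
    case True
    then show ?thesis using component_minimal[OF S(1)] S unfolding separated_def by blast
  next
    case False
    then show ?thesis using component_minimal[OF separated_complement[OF S(1)], of u] S assms
      unfolding separated_def by blast
  qed
qed

text \<open>The vertices of the component that \<open>w\<close> sees in the colour of
  \<open>u\<close> form a separated set: at an edge \<open>x y\<close> leaving it inside the
  component, \<open>c w x\<close> and \<open>c w y\<close> differ and neither is \<open>p\<close>,
  so colour \<open>p\<close> on \<open>x y\<close> would make a rainbow triangle. Minimality of the
  component finishes.\<close>

lemma component_uniform:
  assumes g: "gallai c V" and u: "u \<in> V" and w: "w \<in> V" "w \<notin> component p V u"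
    and z: "z \<in> component p V u"
  shows "c w z = c w u"
proof -
  let ?C = "component p V u"
  let ?T = "{z \<in> ?C. c w z = c w u}"
  have C: "separated p V ?C" using component_separated[OF u] .
  have "separated p V ?T"
    unfolding separated_def
  proof (intro conjI ballI)
    show "?T \<subseteq> V" using C unfolding separated_def by blast
    fix x y assume x: "x \<in> ?T" and y: "y \<in> V - ?T"
    show "c x y \<noteq> p"
    proof (cases "y \<in> ?C")
      case False
      then show ?thesis using C x y unfolding separated_def by blast
    next
      case True
      have ne: "c w y \<noteq> c w x" using x y True by auto
      have xy: "x \<in> V" "y \<in> V" "x \<noteq> y" "x \<noteq> w" "y \<noteq> w"
        using x y C w True ne unfolding separated_def by auto
      have "c x w \<noteq> p" "c y w \<noteq> p" using C x w True unfolding separated_def by blast+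
      moreover have "c w x = c x y \<or> c x y = c w y \<or> c w x = c w y"
        using g xy w unfolding gallai_def by metis
      ultimately show ?thesis using ne sym by metis
    qed
  qed
  then have "?C \<subseteq> ?T" using component_self by (intro component_minimal) auto
  then show ?thesis using z by blast
qed

text \<open>
  The step of an induction on \<open>card V\<close> showing that no three colours are all connected: by symmetry
  of \<open>p\<close>, \<open>q\<close>, \<open>r\<close>, all three would remain connected after deleting any vertex.
\<close>

lemma connected_after_deletion:
  assumes g: "gallai c V" and v: "v \<in> V" and pqr: "p \<noteq> q" "p \<noteq> r" "q \<noteq> r"
    and conn: "connected_in p V" "connected_in q V" "connected_in r V"
    and ne: "V - {v} \<noteq> {}"
  shows "connected_in p (V - {v})"
proof (rule ccontr)
  assume nc: "\<not> connected_in p (V - {v})"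
  let ?W = "V - {v}"
  let ?C = "component p ?W"
  have gW: "gallai c ?W" using g gallai_subset by blast
  have C: "separated p ?W (?C a)" "a \<in> ?C a" "?C a \<noteq> ?W" "?C a \<subseteq> ?W" if "a \<in> ?W" for a
    using component_separated[OF that] component_self component_proper[OF nc that] 
    unfolding separated_def by auto
  have vn: "\<exists>u\<in>?W. c v u = t" if "connected_in t V" for t
    using connected_inE[OF that, of "{v}"] v ne by (metis Diff_cancel Diff_iff empty_subsetI insert_not_empty insert_subset singletonD)
  obtain a where a: "a \<in> ?W" "c v a = q" using vn[OF conn(2)] by blast
  obtain b where b: "b \<in> ?W" "c v b = r" using vn[OF conn(3)] by blast
  \<comment> \<open>In \<open>V\<close> the set \<open>S\<close> is no longer separated, and all its
    edges into the rest of \<open>?W\<close> avoid \<open>p\<close>; the crossing edge of colour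
    \<open>p\<close> must end in \<open>v\<close>.\<close>
  have hit: "\<exists>w\<in>S. c v w = p" if S: "separated p ?W S" "S \<noteq> {}" for S
  proof -
    have "S \<subseteq> V" "S \<noteq> V" using S v unfolding separated_def by auto
    then obtain x y where "x \<in> S" "y \<in> V - S" "c x y = p" using connected_inE[OF conn(1) _ S(2)] by blast
    then show ?thesis using S unfolding separated_def using sym by (metis DiffD1 DiffD2 DiffI singletonD)
  qed
  \<comment> \<open>In the triangle \<open>v w x\<close> only the edge \<open>v w\<close> has colour
    \<open>p\<close>, so the two others agree.\<close>
  have tri: "c w x = c v x"
    if "x \<in> ?W" "w \<in> ?W" "w \<noteq> x" "c v w = p" "c v x \<noteq> p" "c w x \<noteq> p" for w x
    using g that v unfolding gallai_def by (metis DiffD1 DiffD2 singletonI)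
  have out: "c w x \<noteq> p" if "x \<in> ?C a" "w \<in> ?W - ?C a" "a \<in> ?W" for w x a
    using C(1)[OF that(3)] that sym unfolding separated_def by metis
  show False
  proof (cases "b \<in> ?C a")
    \<comment> \<open>A \<open>p\<close>-neighbour \<open>w\<close> of \<open>v\<close> outside the
      component sees \<open>a\<close> in colour \<open>q\<close> and \<open>b\<close> in colour
      \<open>r\<close>, although it must see the whole component in one colour.\<close>
    case True
    obtain w where w: "w \<in> ?W - ?C a" "c v w = p"
      using hit[OF separated_complement[OF C(1)[OF a(1)]]] C(3,4)[OF a(1)] by blast
    have "c w a = q" using tri[of a w] a w out[of a a w] C(2)[OF a(1)] pqr by auto
    moreover have "c w b = r" using tri[of b w] b w out[of b a w] True a pqr by auto
    moreover have "c w b = c w a" using component_uniform[OF gW a(1) _ _ True] w by blast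
    ultimately show False using pqr by simp
  next
    \<comment> \<open>Each of the two components contains a \<open>p\<close>-neighbour of
      \<open>v\<close>. Uniformity in both directions makes the edge \<open>a b\<close> have colour
      \<open>r\<close> as well as colour \<open>q\<close>.\<close>
    case False
    have sub: "?C b \<subseteq> ?W - ?C a"
      using component_minimal[OF separated_complement[OF C(1)[OF a(1)]]] b False by blast
    have an: "a \<notin> ?C b" using sub C(2)[OF a(1)] by blast
    obtain w where w: "w \<in> ?C a" "c v w = p" using hit[OF C(1)[OF a(1)]] C(2)[OF a(1)] by blast
    obtain x where x: "x \<in> ?C b" "c v x = p" using hit[OF C(1)[OF b(1)]] C(2)[OF b(1)] by blast
    have wn: "w \<in> ?W - ?C b" using w sub C(4)[OF a(1)] by blast
    have xn: "x \<in> ?W - ?C a" using x sub by blast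
    have "c w b = r" using tri[of b w] b w wn out[of b b w] C(2)[OF b(1)] pqr by auto
    moreover have "c x a = q" using tri[of a x] a x xn out[of a a x] C(2)[OF a(1)] pqr by auto
    moreover have "c b w = c b a" using component_uniform[OF gW a(1) b(1) False w(1)] .
    moreover have "c a x = c a b" using component_uniform[OF gW b(1) a(1) an x(1)] .
    ultimately show False using sym pqr by metis
  qed
qed

lemma not_three_connected:
  assumes "finite V" "gallai c V" "card V \<ge> 2" "p \<noteq> q" "p \<noteq> r" "q \<noteq> r"
  shows "\<not> (connected_in p V \<and> connected_in q V \<and> connected_in r V)"
  using assms
proof (induction "card V" arbitrary: V rule: less_induct)
  case less
  show ?case
  proof
    assume conn: "connected_in p V \<and> connected_in q V \<and> connected_in r V"
    have "V \<noteq> {}" using less.prems by auto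
    then obtain v where v: "v \<in> V" by blast
    have cV: "card (V - {v}) = card V - 1" using v less.prems by simp
    have ne: "V - {v} \<noteq> {}"
    proof
      assume "V - {v} = {}"
      then have "card (V - {v}) = 0" by (simp only: card.empty)
      then show False using cV less.prems(3) by linarith
    qed
    note d = connected_after_deletion[OF less.prems(2) v _ _ _ _ _ _ ne]
    have con': "connected_in p (V - {v})" "connected_in q (V - {v})" "connected_in r (V - {v})"
      using d[of p q r] d[of q p r] d[of r p q] conn less.prems by auto
    show False
    proof (cases "card V = 2")
      case False
      have "2 \<le> card (V - {v})" "card (V - {v}) < card V" using False less.prems(3) cV by linarith+
      then show False using less.hyps[of "V - {v}"] con' less.prems gallai_subset[of c V "V - {v}"] by auto
    next
      \<comment> \<open>Here the induction ends: the single edge would have to carry all three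
        colours.\<close>
      case True
      then obtain x y where V: "V = {x, y}" "x \<noteq> y" by (auto simp: card_2_iff)
      have "c x y = t" if "connected_in t V" for t
        using connected_inE[OF that, of "{x}"] V by auto
      then show False using conn less.prems by metis
    qed
  qed
qed

text \<open>One of the three colours disconnects \<open>V\<close>, and a component of that colour is
  a module. Choosing the component of an endpoint of an edge of that very colour guarantees two
  vertices.\<close>

lemma exists_proper_module:
  assumes "finite V" "gallai c V" "p \<noteq> q" "p \<noteq> r" "q \<noteq> r"
    and used: "\<And>t. t \<in> {p, q, r} \<Longrightarrow> \<exists>x\<in>V. \<exists>y\<in>V. x \<noteq> y \<and> c x y = t"
  shows "\<exists>M. M \<subset> V \<and> card M \<ge> 2 \<and> (\<forall>w\<in>V - M. \<forall>x\<in>M. \<forall>y\<in>M. c w x = c w y)"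
proof -
  have "card V \<ge> 2"
  proof -
    obtain x y where "x \<in> V" "y \<in> V" "x \<noteq> y" using used[of p] by blast
    then have "card {x, y} \<le> card V" using assms(1) by (intro card_mono) auto
    then show ?thesis using \<open>x \<noteq> y\<close> by simp
  qed
  then obtain t where t: "t \<in> {p, q, r}" "\<not> connected_in t V"
    using not_three_connected[OF assms(1,2) _ assms(3-5)] by blast
  obtain x y where xy: "x \<in> V" "y \<in> V" "x \<noteq> y" "c x y = t" using used[OF t(1)] by blast
  let ?M = "component t V x"
  have M: "separated t V ?M" using component_separated xy by blast
  have "y \<in> ?M" using M xy component_self[of x t V] unfolding separated_def by blast
  then have "card {x, y} \<le> card ?M"
    using M assms(1) component_self[of x t V] unfolding separated_def
    by (intro card_mono) (auto intro: finite_subset)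
  then have "card ?M \<ge> 2" using xy by simp
  moreover have "?M \<subset> V" using M component_proper[OF t(2) xy(1)] unfolding separated_def by blast
  moreover have "\<forall>w\<in>V - ?M. \<forall>a\<in>?M. \<forall>b\<in>?M. c w a = c w b"
    using component_uniform[OF assms(2) xy(1)] by (metis DiffD1 DiffD2)
  ultimately show ?thesis by blast
qed

lemma bad_module:
  assumes "M \<subseteq> V" "\<forall>w\<in>V - M. \<forall>x\<in>M. \<forall>y\<in>M. c w x = c w y" "set xs \<subseteq> M"
  shows "bad c V \<kappa> xs = bad c M \<kappa> xs"
proof -
  have "fits \<kappa> (c b) xs" if "b \<in> V - M" for b
    using assms that by (intro fits_constant) blast
  then show ?thesis using assms(1) unfolding bad_def by blast
qed

lemma two_colours_or_module:
  assumes "finite V" "gallai c V"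
  obtains p q where "\<And>x y. x \<in> V \<Longrightarrow> y \<in> V \<Longrightarrow> x \<noteq> y \<Longrightarrow> c x y = p \<or> c x y = q"
  | M where "M \<subset> V" "card M \<ge> 2" "\<forall>w\<in>V - M. \<forall>x\<in>M. \<forall>y\<in>M. c w x = c w y"
proof -
  let ?U = "{t. \<exists>x\<in>V. \<exists>y\<in>V. x \<noteq> y \<and> c x y = t}"
  show thesis
  proof (cases "\<exists>p q r. p \<in> ?U \<and> q \<in> ?U \<and> r \<in> ?U \<and> p \<noteq> q \<and> p \<noteq> r \<and> q \<noteq> r")
    case True
    then obtain p q r where pqr: "p \<in> ?U" "q \<in> ?U" "r \<in> ?U" "p \<noteq> q" "p \<noteq> r" "q \<noteq> r" by blast
    have "\<exists>x\<in>V. \<exists>y\<in>V. x \<noteq> y \<and> c x y = t" if "t \<in> {p, q, r}" for t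
      using that pqr(1-3) by blast
    then have "\<exists>M. M \<subset> V \<and> card M \<ge> 2 \<and> (\<forall>w\<in>V - M. \<forall>x\<in>M. \<forall>y\<in>M. c w x = c w y)"
      by (rule exists_proper_module[OF assms pqr(4-6)])
    then show thesis by (elim exE conjE) (rule that(2))
  next
    case False
    then have "\<exists>p q. \<forall>t\<in>?U. t = p \<or> t = q" by (rule at_most_two_elements)
    then obtain p q where pq: "\<forall>t\<in>?U. t = p \<or> t = q" by blast
    show thesis
    proof (rule that(1))
      fix x y assume "x \<in> V" "y \<in> V" "x \<noteq> y"
      then show "c x y = p \<or> c x y = q" using pq by blast
    qed
  qed
qed

section \<open>Averaging over ordered pairs and triples\<close>

text \<open>With two colours and every \<open>\<kappa>\<close> equal to \<open>p\<close>, a vertex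
  fits exactly if its edges along the small side are a run of \<open>p\<close> followed by a run of
  the other colour. A failure is a consecutive change from not-\<open>p\<close> to \<open>p\<close>,
  and this set collects those changes.\<close>

definition switch :: "'c \<Rightarrow> 'a set \<Rightarrow> 'a \<Rightarrow> 'a \<Rightarrow> 'a set" where
  "switch p V x y = {b \<in> V - {x, y}. c b x \<noteq> p \<and> c b y = p}"

lemma finite_switch: "finite V \<Longrightarrow> finite (switch p V x y)"
  unfolding switch_def by simp

text \<open>Double counting: a vertex with \<open>m\<close> edges of colour \<open>p\<close> and
  \<open>n\<close> others lies in the sets of exactly \<open>m * n\<close> ordered pairs, and
  \<open>m + n = card V - 1\<close>.\<close>

lemma sum_card_switch:
  assumes fin: "finite V"
  shows "4 * (\<Sum>x\<in>V. \<Sum>y\<in>V. card (switch p V x y)) \<le> card V * (card V - 1)^2"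
proof -
  let ?P = "\<lambda>b x. b \<noteq> x \<and> c b x \<noteq> p" and ?Q = "\<lambda>b y. b \<noteq> y \<and> c b y = p"
  have card_eq: "card {x \<in> V. H x} = (\<Sum>x\<in>V. of_bool (H x))" for H
    using fin by (simp add: Int_def)
  have "card (switch p V x y) = (\<Sum>b\<in>V. of_bool (?P b x) * of_bool (?Q b y))" for x y
  proof -
    have "switch p V x y = {b \<in> V. ?P b x \<and> ?Q b y}" unfolding switch_def by auto
    then show ?thesis by (simp only: card_eq of_bool_conj)
  qed
  then have "(\<Sum>x\<in>V. \<Sum>y\<in>V. card (switch p V x y))
      = (\<Sum>x\<in>V. \<Sum>y\<in>V. \<Sum>b\<in>V. of_bool (?P b x) * of_bool (?Q b y))" by simp
  also have "\<dots> = (\<Sum>x\<in>V. \<Sum>b\<in>V. \<Sum>y\<in>V. of_bool (?P b x) * of_bool (?Q b y))"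
    by (intro sum.cong refl sum.swap)
  also have "\<dots> = (\<Sum>b\<in>V. \<Sum>x\<in>V. \<Sum>y\<in>V. of_bool (?P b x) * of_bool (?Q b y))"
    by (rule sum.swap)
  also have "\<dots> = (\<Sum>b\<in>V. card {x \<in> V. ?P b x} * card {y \<in> V. ?Q b y})"
    by (simp only: card_eq sum_product)
  finally have eq: "(\<Sum>x\<in>V. \<Sum>y\<in>V. card (switch p V x y))
      = (\<Sum>b\<in>V. card {x \<in> V. ?P b x} * card {y \<in> V. ?Q b y})" .
  have "4 * (card {x \<in> V. ?P b x} * card {y \<in> V. ?Q b y}) \<le> (card V - 1)^2" if b: "b \<in> V" for b
  proof -
    have "card {x \<in> V. ?P b x} + card {y \<in> V. ?Q b y} = card ({x \<in> V. ?P b x} \<union> {y \<in> V. ?Q b y})"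
      using fin by (intro card_Un_disjoint[symmetric]) auto
    also have "{x \<in> V. ?P b x} \<union> {y \<in> V. ?Q b y} = V - {b}" by auto
    finally have "card {x \<in> V. ?P b x} + card {y \<in> V. ?Q b y} = card V - 1" using b fin by simp
    from four_mult_le_power2[of "card {x \<in> V. ?P b x}" "card {y \<in> V. ?Q b y}", unfolded this]
    show ?thesis .
  qed
  then have "(\<Sum>b\<in>V. 4 * (card {x \<in> V. ?P b x} * card {y \<in> V. ?Q b y})) \<le> (\<Sum>b\<in>V. (card V - 1)^2)"
    by (rule sum_mono)
  then show ?thesis unfolding eq by (simp add: sum_distrib_left)
qed

text \<open>The average over the ordered pairs of distinct vertices is at most
  \<open>(card V - 1) / 4\<close>.\<close>

lemma small_switch:
  assumes fin: "finite V" and V: "card V \<ge> 2"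
  shows "\<exists>x\<in>V. \<exists>y\<in>V. x \<noteq> y \<and> 4 * card (switch p V x y) < card V"
proof (rule ccontr)
  assume "\<not> ?thesis"
  then have large: "card V \<le> 4 * card (switch p V x y)" if "x \<in> V" "y \<in> V" "x \<noteq> y" for x y
    using that by force
  have "card V * ((card V - 1) * card V) = (\<Sum>x\<in>V. \<Sum>y\<in>V - {x}. card V)"
    using fin by simp
  also have "\<dots> \<le> (\<Sum>x\<in>V. \<Sum>y\<in>V - {x}. 4 * card (switch p V x y))"
    using large by (intro sum_mono) auto
  also have "\<dots> \<le> (\<Sum>x\<in>V. \<Sum>y\<in>V. 4 * card (switch p V x y))"
    using fin by (intro sum_mono sum_mono2) auto
  also have "\<dots> \<le> card V * (card V - 1)^2"
    using sum_card_switch[OF fin, of p] by (simp add: sum_distrib_left)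
  finally show False using V by (simp add: power2_eq_square)
qed

text \<open>With \<open>N = card V\<close>, the bracketed sum averages at most
  \<open>(N - 3) * (N - 1) / (2 * (N - 2))\<close> over ordered triples, which is below
  \<open>(N - 2) / 2\<close>. The factor \<open>N - 3\<close> is the gain from deleting the third
  vertex.\<close>

lemma small_switch_triple:
  assumes fin: "finite V" and V: "card V \<ge> 3"
  shows "\<exists>x\<in>V. \<exists>y\<in>V. \<exists>z\<in>V. x \<noteq> y \<and> y \<noteq> z \<and> x \<noteq> z \<and>
    2 * (card (switch p V x y - {z}) + card (switch p V y z - {x})) + 3 \<le> card V"
proof (rule ccontr)
  assume contr: "\<not> ?thesis"
  let ?N = "card V"
  \<comment> \<open>Ordered triples of distinct vertices as one set: it unfolds into iterated sums
    and can also be reindexed by a rotation.\<close>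
  let ?T = "Sigma V (\<lambda>x. Sigma (V - {x}) (\<lambda>y. V - {x, y}))"
  let ?g = "\<lambda>x y z. card (switch p V x y - {z})"
  have large: "?N - 2 \<le> 2 * (?g x y z + ?g y z x)" if "(x, y, z) \<in> ?T" for x y z
  proof -
    have "\<not> 2 * (?g x y z + ?g y z x) + 3 \<le> ?N" proof -
      have "x \<in> V" "y \<in> V" "z \<in> V" "x \<noteq> y" "y \<noteq> z" "x \<noteq> z" using that by auto
      then show ?thesis using contr by blast
    qed
    then show ?thesis by linarith
  qed
  have fT: "finite (Sigma (V - {x}) (\<lambda>y. V - {x, y}))" for x using fin by auto
  have cV2: "card (V - {x, y}) = ?N - 2" if "x \<in> V" "y \<in> V - {x}" for x y
    using that fin by (auto simp: card_Diff_subset)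
  have T: "(\<Sum>(x, y, z)\<in>?T. h x y z) = (\<Sum>x\<in>V. \<Sum>y\<in>V - {x}. \<Sum>z\<in>V - {x, y}. h x y z)"
    for h :: "'a \<Rightarrow> 'a \<Rightarrow> 'a \<Rightarrow> nat"
    using fin by (simp add: sum.Sigma[symmetric] fT)
  have "(\<Sum>(x, y, z)\<in>?T. ?g x y z) = (\<Sum>x\<in>V. \<Sum>y\<in>V - {x}. (?N - 3) * card (switch p V x y))"
    unfolding T
  proof (intro sum.cong refl)
    fix x y assume xy: "x \<in> V" "y \<in> V - {x}"
    have "switch p V x y \<subseteq> V - {x, y}" unfolding switch_def by blast
    then show "(\<Sum>z\<in>V - {x, y}. ?g x y z) = (?N - 3) * card (switch p V x y)"
      using fin cV2[OF xy] by (simp add: sum_card_remove)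
  qed
  also have "\<dots> \<le> (\<Sum>x\<in>V. \<Sum>y\<in>V. (?N - 3) * card (switch p V x y))"
    using fin by (intro sum_mono sum_mono2) auto
  also have "\<dots> = (?N - 3) * (\<Sum>x\<in>V. \<Sum>y\<in>V. card (switch p V x y))"
    by (simp only: sum_distrib_left)
  finally have "4 * (\<Sum>(x, y, z)\<in>?T. ?g x y z) \<le> 4 * ((?N - 3) * (\<Sum>x\<in>V. \<Sum>y\<in>V. card (switch p V x y)))"
    by (rule mult_le_mono2)
  also have "\<dots> = (?N - 3) * (4 * (\<Sum>x\<in>V. \<Sum>y\<in>V. card (switch p V x y)))"
    by (rule mult.left_commute)
  also have "\<dots> \<le> (?N - 3) * (?N * (?N - 1)^2)"
    by (intro mult_le_mono2 sum_card_switch fin)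
  finally have S: "4 * (\<Sum>(x, y, z)\<in>?T. ?g x y z) \<le> (?N - 3) * (?N * (?N - 1)^2)" .
  \<comment> \<open>Cyclic rotation of the triple exchanges the two halves of the bracketed sum, so
    one estimate serves both.\<close>
  have rot: "(\<Sum>(x, y, z)\<in>?T. ?g y z x) = (\<Sum>(x, y, z)\<in>?T. ?g x y z)"
    by (rule sum.reindex_bij_witness[of _ "\<lambda>(x, y, z). (z, x, y)" "\<lambda>(x, y, z). (y, z, x)"]) auto
  have "?N * ((?N - 1) * ((?N - 2) * (?N - 2))) = (\<Sum>(x, y, z)\<in>?T. ?N - 2)"
    unfolding T using fin cV2 by simp
  also have "\<dots> \<le> (\<Sum>(x, y, z)\<in>?T. 2 * (?g x y z + ?g y z x))"
    using large by (intro sum_mono) auto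
  also have "\<dots> = 2 * ((\<Sum>(x, y, z)\<in>?T. ?g x y z) + (\<Sum>(x, y, z)\<in>?T. ?g y z x))"
    by (simp add: sum_distrib_left sum.distrib[symmetric] split_def)
  also have "\<dots> \<le> (?N - 3) * (?N * (?N - 1)^2)" unfolding rot using S by simp
  also have "\<dots> = ?N * ((?N - 1) * ((?N - 3) * (?N - 1)))" by (simp add: power2_eq_square)
  \<comment> \<open>impossible, as \<open>(N - 3) * (N - 1) = (N - 2)\<^sup>2 - 1\<close>\<close>
  finally have "(?N - 2) * (?N - 2) \<le> (?N - 3) * (?N - 1)" using V by simp
  moreover obtain n where "?N = n + 3" using V by (metis add.commute le_Suc_ex)
  ultimately show False by simp
qed

section \<open>Few bad vertices for some pair or triple\<close>

theorem gallai_pair: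
  assumes "finite V" "gallai c V" "card V \<ge> 2"
  shows "\<exists>x\<in>V. \<exists>y\<in>V. \<exists>k. x \<noteq> y \<and> 4 * card (bad c V (\<lambda>_. k) [x, y]) < card V"
  using assms
proof (induction "card V" arbitrary: V rule: less_induct)
  case less
  from two_colours_or_module[OF less.prems(1,2)] show ?case
  proof cases
    case (1 p q)
    obtain x y where xy: "x \<in> V" "y \<in> V" "x \<noteq> y" "4 * card (switch p V x y) < card V"
      using small_switch[OF less.prems(1,3)] by blast
    have "bad c V (\<lambda>_. p) [x, y] \<subseteq> switch p V x y"
    proof
      fix b assume b: "b \<in> bad c V (\<lambda>_. p) [x, y]"
      then have "b \<in> V" "b \<noteq> x" "b \<noteq> y" "c b y \<noteq> c b x" "c b x \<noteq> p" by (auto simp: bad_def)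
      then show "b \<in> switch p V x y" using 1[of b x] 1[of b y] xy by (auto simp: switch_def)
    qed
    then have "card (bad c V (\<lambda>_. p) [x, y]) \<le> card (switch p V x y)"
      using less.prems(1) by (intro card_mono finite_switch)
    then have "4 * card (bad c V (\<lambda>_. p) [x, y]) < card V" using xy(4) by linarith
    then show ?thesis using xy(1-3) by blast
  next
    case (2 M)
    have M: "card M < card V" "finite M" "gallai c M"
      using 2 less.prems by (auto intro: psubset_card_mono finite_subset gallai_subset)
    obtain x y k where xy: "x \<in> M" "y \<in> M" "x \<noteq> y" "4 * card (bad c M (\<lambda>_. k) [x, y]) < card M"
      using less.hyps[OF M 2(2)] by blast
    have "bad c V (\<lambda>_. k) [x, y] = bad c M (\<lambda>_. k) [x, y]"
      using xy by (intro bad_module[OF psubset_imp_subset[OF 2(1)] 2(3)]) simp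
    then have "4 * card (bad c V (\<lambda>_. k) [x, y]) < card V" using xy(4) M(1) by simp
    then show ?thesis using xy(1-3) 2(1) by blast
  qed
qed

text \<open>Descending into a module works as for pairs until the module has only two vertices and
  contains no triple; that case needs a direct argument.\<close>

theorem gallai_triple:
  assumes "finite V" "gallai c V" "card V \<ge> 3"
  shows "\<exists>x\<in>V. \<exists>y\<in>V. \<exists>z\<in>V. \<exists>k. x \<noteq> y \<and> y \<noteq> z \<and> x \<noteq> z \<and> 2 * card (bad c V (\<lambda>_. k) [x, y, z]) + 3 \<le> card V"
  using assms
proof (induction "card V" arbitrary: V rule: less_induct)
  case less
  note fin = less.prems(1)
  from two_colours_or_module[OF less.prems(1,2)] show ?case
  proof cases
    case (1 p q)
    obtain x y z where xyz: "x \<in> V" "y \<in> V" "z \<in> V" "x \<noteq> y" "y \<noteq> z" "x \<noteq> z"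
      "2 * (card (switch p V x y - {z}) + card (switch p V y z - {x})) + 3 \<le> card V"
      using small_switch_triple[OF less.prems(1,3)] by blast
    let ?U = "(switch p V x y - {z}) \<union> (switch p V y z - {x})"
    have "bad c V (\<lambda>_. p) [x, y, z] \<subseteq> ?U"
    proof
      fix b assume b: "b \<in> bad c V (\<lambda>_. p) [x, y, z]"
      then show "b \<in> ?U" using 1[of b x] 1[of b y] 1[of b z] xyz by (auto simp: switch_def bad_def)
    qed
    then have "card (bad c V (\<lambda>_. p) [x, y, z]) \<le> card ?U"
      using fin by (intro card_mono) (auto intro: finite_switch)
    also have "\<dots> \<le> card (switch p V x y - {z}) + card (switch p V y z - {x})" by (rule card_Un_le)
    finally have "2 * card (bad c V (\<lambda>_. p) [x, y, z]) + 3 \<le> card V"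
      using xyz(7) by (meson add_le_mono1 mult_le_mono2 order_trans)
    then show ?thesis using xyz(1-6) by blast
  next
    case (2 M)
    have M: "card M < card V" "finite M" "gallai c M"
      using 2 less.prems by (auto intro: psubset_card_mono finite_subset gallai_subset)
    show ?thesis
    proof (cases "card M \<ge> 3")
      case True
      obtain x y z k where xy: "x \<in> M" "y \<in> M" "z \<in> M" "x \<noteq> y" "y \<noteq> z" "x \<noteq> z" "2 * card (bad c M (\<lambda>_. k) [x, y, z]) + 3 \<le> card M"
        using less.hyps[OF M True] by blast
      have "bad c V (\<lambda>_. k) [x, y, z] = bad c M (\<lambda>_. k) [x, y, z]"
        using xy by (intro bad_module[OF psubset_imp_subset[OF 2(1)] 2(3)]) simp
      then have "2 * card (bad c V (\<lambda>_. k) [x, y, z]) + 3 \<le> card V" using xy(7) M(1) by simp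
      then show ?thesis using xy(1-6) 2(1) by blast
    next
      case False
      \<comment> \<open>All outside vertices see \<open>x\<close> and \<open>y\<close> alike. With
        any third vertex \<open>a\<close> and the colour \<open>c a x\<close>, the orders
        \<open>a, x, y\<close> and \<open>x, y, a\<close> turn out to have disjoint bad sets among
        \<open>card V - 3\<close> vertices, so one of them is at most half of that.\<close>
      then have "card M = 2" using 2 by simp
      then obtain x y where xy: "M = {x, y}" "x \<noteq> y" by (auto simp: card_2_iff)
      obtain a where "a \<in> V - M" using psubset_imp_ex_mem[OF 2(1)] by (elim exE)
      then have a: "a \<in> V" "a \<noteq> x" "a \<noteq> y" using xy(1) by simp_all
      have xyV: "x \<in> V" "y \<in> V" using psubset_imp_subset[OF 2(1)] xy(1) by simp_all
      have eq: "c b y = c b x" if "b \<in> V" "b \<noteq> x" "b \<noteq> y" for b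
        using 2(3)[rule_format, of b y x] that xy(1) by simp
      \<comment> \<open>A vertex bad for both orders would form a rainbow triangle with \<open>a\<close> and \<open>x\<close>.\<close>
      let ?\<kappa> = "\<lambda>_::'a. c a x"
      let ?B = "bad c V ?\<kappa> [a, x, y]" and ?C = "bad c V ?\<kappa> [x, y, a]"
      have B: "?B = {b \<in> V - {a, x, y}. c b x \<noteq> c b a \<and> c b a \<noteq> c a x}"
        using eq by (auto simp: bad_def)
      have C: "?C = {b \<in> V - {a, x, y}. c b x \<noteq> c b a \<and> c b x \<noteq> c a x}"
        using eq by (auto simp: bad_def)
      have "?B \<inter> ?C = {}"
      proof (rule equals0I)
        have tri: "c b a = c a x \<or> c a x = c b x \<or> c b a = c b x" if "b \<in> V - {a, x, y}" for b
          using less.prems(2) that a xyV unfolding gallai_def by blast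
        fix b assume "b \<in> ?B \<inter> ?C"
        then have b: "b \<in> V - {a, x, y}" "c b x \<noteq> c b a" "c b a \<noteq> c a x" "c b x \<noteq> c a x"
          unfolding B C by simp_all
        show False using tri[OF b(1)] b(2-4) by simp
      qed
      moreover have fBC: "finite ?B" "finite ?C" using fin by (auto simp: bad_def)
      ultimately have "card ?B + card ?C = card (?B \<union> ?C)" by (simp add: card_Un_disjoint)
      also have "\<dots> \<le> card (V - {a, x, y})" using fin unfolding B C by (intro card_mono) auto
      also have "\<dots> = card V - 3" using fin a xyV xy by (simp add: card_Diff_subset)
      finally have "2 * card ?B + 3 \<le> card V \<or> 2 * card ?C + 3 \<le> card V" using less.prems(3) by linarith
      then show ?thesis
      proof
        assume "2 * card ?B + 3 \<le> card V"
        then show ?thesis using a xyV xy(2) by blast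
      next
        assume "2 * card ?C + 3 \<le> card V"
        then show ?thesis using a(1) a(2,3)[symmetric] xyV xy(2) by blast
      qed
    qed
  qed
qed

end

section \<open>Roots of unity in algebraically closed fields\<close>

lemma (in ring_hom_cring) hom_power:
  "x \<in> carrier R \<Longrightarrow> h (x [^] (n :: nat)) = h x [^]\<^bsub>S\<^esub> n"
  by (induction n) auto

text \<open>A substitute for the formal derivative: when \<open>h\<close> evaluates polynomials at a
  point, \<open>x\<close> is the variable and \<open>a\<close> the constant at that point,
  \<open>h g\<close> is the derivative of the power there.\<close>

lemma (in ring_hom_cring) power_diff_factor:
  assumes "x \<in> carrier R" "a \<in> carrier R" "h x = h a"
  shows "\<exists>g\<in>carrier R. x [^] Suc m \<ominus> a [^] Suc m = (x \<ominus> a) \<otimes> g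
           \<and> h g = add_pow S (Suc m) (h a [^]\<^bsub>S\<^esub> m)"
proof (induction m)
  case 0
  show ?case using assms by (intro bexI[of _ \<one>]) (auto simp: S.add.nat_pow_Suc)
next
  case (Suc m)
  then obtain g where g: "g \<in> carrier R" "x [^] Suc m \<ominus> a [^] Suc m = (x \<ominus> a) \<otimes> g"
    "h g = add_pow S (Suc m) (h a [^]\<^bsub>S\<^esub> m)" by blast
  let ?g = "x \<otimes> g \<oplus> a [^] Suc m"
  have "x [^] Suc (Suc m) \<ominus> a [^] Suc (Suc m)
      = x \<otimes> (x [^] Suc m \<ominus> a [^] Suc m) \<oplus> (x \<ominus> a) \<otimes> a [^] Suc m"
  proof -
    have "x [^] Suc m \<in> carrier R" "a [^] Suc m \<in> carrier R" using assms by auto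
    then show ?thesis using assms(1,2) unfolding R.nat_pow_Suc[of _ "Suc m"] by algebra
  qed
  also have "\<dots> = x \<otimes> ((x \<ominus> a) \<otimes> g) \<oplus> (x \<ominus> a) \<otimes> a [^] Suc m"
    using g(2) by simp
  also have "\<dots> = (x \<ominus> a) \<otimes> ?g"
  proof -
    have "a [^] Suc m \<in> carrier R" using assms by auto
    then show ?thesis using assms(1,2) g(1) by algebra
  qed
  finally have 1: "x [^] Suc (Suc m) \<ominus> a [^] Suc (Suc m) = (x \<ominus> a) \<otimes> ?g" .
  have "h ?g = h a \<otimes>\<^bsub>S\<^esub> add_pow S (Suc m) (h a [^]\<^bsub>S\<^esub> m) \<oplus>\<^bsub>S\<^esub> h a [^]\<^bsub>S\<^esub> Suc m"
    using assms g by (simp add: hom_power del: R.nat_pow_Suc S.nat_pow_Suc)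
  also have "\<dots> = add_pow S (Suc m) (h a \<otimes>\<^bsub>S\<^esub> h a [^]\<^bsub>S\<^esub> m) \<oplus>\<^bsub>S\<^esub> h a [^]\<^bsub>S\<^esub> Suc m"
    using assms by (subst S.add_pow_rdistr) auto
  also have "h a \<otimes>\<^bsub>S\<^esub> h a [^]\<^bsub>S\<^esub> m = h a [^]\<^bsub>S\<^esub> Suc m"
    using assms S.nat_pow_Suc2 by simp
  also have "add_pow S (Suc m) (h a [^]\<^bsub>S\<^esub> Suc m) \<oplus>\<^bsub>S\<^esub> h a [^]\<^bsub>S\<^esub> Suc m
     = add_pow S (Suc (Suc m)) (h a [^]\<^bsub>S\<^esub> Suc m)"
    by (simp add: S.add.nat_pow_Suc del: S.nat_pow_Suc)
  finally show ?case using 1 assms g(1) by (intro bexI[of _ ?g]) auto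
qed

text \<open>The binomial theorem for sums \<open>\<one> \<oplus> x\<close>; in a field the general
  sum is reached by factoring out a nonzero summand.\<close>

lemma (in cring) one_plus_power:
  assumes x: "x \<in> carrier R"
  shows "(\<one> \<oplus> x) [^] n = (\<Oplus>i\<in>{..n}. add_pow R (n choose i) (x [^] i))"
proof (induction n)
  case 0
  show ?case using x by simp
next
  case (Suc n)
  let ?f = "\<lambda>n i. add_pow R (n choose i) (x [^] i)"
  let ?g = "\<lambda>i. add_pow R (n choose i) (x [^] Suc i)"
  have f: "?f n \<in> A \<rightarrow> carrier R" "?g \<in> A \<rightarrow> carrier R" for n A using x by auto
  have fc: "(\<Oplus>i\<in>A. ?f n i) \<in> carrier R" "(\<Oplus>i\<in>A. ?g i) \<in> carrier R" 
    "(\<Oplus>i\<in>A. ?f n (Suc i)) \<in> carrier R" for n A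
    using x by (auto intro!: finsum_closed)
  have "(\<one> \<oplus> x) [^] Suc n = (\<Oplus>i\<in>{..n}. ?f n i) \<oplus> (\<Oplus>i\<in>{..n}. ?f n i) \<otimes> x"
    using x fc(1)[of n "{..n}"] Suc by (simp add: r_distr)
  also have "(\<Oplus>i\<in>{..n}. ?f n i) \<otimes> x = (\<Oplus>i\<in>{..n}. ?g i)"
    using x by (simp add: finsum_ldistr add_pow_ldistr Pi_def)
  \<comment> \<open>The added term vanishes because \<open>n choose Suc n = 0\<close>; splitting off
    index \<open>0\<close> instead then aligns both sums for Pascal's rule.\<close>
  also have "(\<Oplus>i\<in>{..n}. ?f n i) = (\<Oplus>i\<in>{..Suc n}. ?f n i)"
    using x f fc by (subst finsum_Suc) (auto simp: binomial_eq_0)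
  also have "\<dots> = (\<Oplus>i\<in>{..n}. ?f n (Suc i)) \<oplus> \<one>"
    using x f by (subst finsum_Suc2) auto
  also have "\<dots> \<oplus> (\<Oplus>i\<in>{..n}. ?g i) = ((\<Oplus>i\<in>{..n}. ?g i) \<oplus> (\<Oplus>i\<in>{..n}. ?f n (Suc i))) \<oplus> \<one>"
    using fc(2)[of "{..n}"] fc(3)[of n "{..n}"] one_closed by (simp only: a_ac a_closed)
  also have "(\<Oplus>i\<in>{..n}. ?g i) \<oplus> (\<Oplus>i\<in>{..n}. ?f n (Suc i)) = (\<Oplus>i\<in>{..n}. ?f (Suc n) (Suc i))"
    using x by (subst finsum_addf[symmetric]) (auto intro!: finsum_cong' simp: add.nat_pow_mult[symmetric])
  also have "\<dots> \<oplus> \<one> = (\<Oplus>i\<in>{..Suc n}. ?f (Suc n) i)"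
  proof -
    have "?f (Suc n) 0 = \<one>" by simp
    then show ?thesis using finsum_Suc2[OF f(1)[of "Suc n" "{..Suc n}"]] by (simp only:)
  qed
  finally show ?case .
qed

lemma (in cring) frobenius_one_plus:
  assumes p: "Factorial_Ring.prime (p :: nat)" "add_pow R p \<one> = \<zero>" and x: "x \<in> carrier R"
  shows "(\<one> \<oplus> x) [^] p = \<one> \<oplus> x [^] p"
proof -
  \<comment> \<open>Writing \<open>p\<close> as \<open>k + 2\<close> makes the inner binomial
    indices exactly \<open>Suc i\<close> with \<open>i \<le> k\<close>; these coefficients are
    divisible by \<open>p\<close>.\<close>
  obtain k where k: "p = Suc (Suc k)" using prime_ge_2_nat[OF p(1)] by (metis add_2_eq_Suc le_Suc_ex)
  let ?f = "\<lambda>i. add_pow R (p choose i) (x [^] i)"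
  have z: "?f (Suc i) = \<zero>" if "i \<le> k" for i
  proof -
    have "p dvd p choose Suc i" using p(1) that k by (intro dvd_choose_prime) auto
    then obtain c where c: "p choose Suc i = p * c" by blast
    let ?y = "add_pow R c (x [^] Suc i)"
    have "?f (Suc i) = add_pow R p ?y"
      unfolding c using x by (subst mult.commute) (simp add: add.nat_pow_pow del: nat_pow_Suc)
    also have "\<dots> = add_pow R p \<one> \<otimes> ?y" using x by (subst add_pow_ldistr) auto
    finally show ?thesis using p(2) x by simp
  qed
  have "(\<one> \<oplus> x) [^] p = (\<Oplus>i\<in>{..Suc (Suc k)}. ?f i)" using one_plus_power[OF x, of p] k by simp
  also have "\<dots> = ?f (Suc (Suc k)) \<oplus> ((\<Oplus>i\<in>{..k}. ?f (Suc i)) \<oplus> ?f 0)"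
    using x by (subst finsum_Suc, simp, subst finsum_Suc2) auto
  also have "(\<Oplus>i\<in>{..k}. ?f (Suc i)) = (\<Oplus>i\<in>{..k}. \<zero>)"
    using z by (intro finsum_cong') auto
  finally show ?thesis using x k by (simp add: a_comm del: nat_pow_Suc)
qed

lemma (in cring) frobenius_iterated:
  assumes p: "Factorial_Ring.prime (p :: nat)" "add_pow R p \<one> = \<zero>" and x: "x \<in> carrier R"
  shows "(\<one> \<oplus> x) [^] (p ^ k) = \<one> \<oplus> x [^] (p ^ k)"
proof (induction k)
  case (Suc k)
  have "(\<one> \<oplus> x) [^] (p ^ Suc k) = ((\<one> \<oplus> x) [^] (p ^ k)) [^] p"
    using x by (simp add: nat_pow_pow) (simp add: mult.commute)
  also have "\<dots> = \<one> \<oplus> (x [^] (p ^ k)) [^] p"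
    using Suc frobenius_one_plus[OF p] x by simp
  finally show ?case using x by (simp add: nat_pow_pow) (simp add: mult.commute)
qed (use x in simp)

lemma (in domain) power_nonzero:
  "x \<in> carrier R \<Longrightarrow> x \<noteq> \<zero> \<Longrightarrow> x [^] (n :: nat) \<noteq> \<zero>"
  by (induction n) (auto simp: integral_iff)

text \<open>The polynomial \<open>X^m - 1\<close> splits, so its roots counted with multiplicity
  number \<open>m\<close>. What remains is that all roots are simple, and this is where
  \<open>m\<close> being nonzero in \<open>L\<close> enters.\<close>

lemma (in algebraically_closed) card_roots_of_unity:
  assumes m: "add_pow L m \<one> \<noteq> \<zero>"
  shows "card {x \<in> carrier L. x [^] m = \<one>} = m"
proof -
  have "m \<noteq> 0" using m by (metis add.nat_pow_0)
  then obtain k where mk: "m = Suc k" by (metis not0_implies_Suc)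
  let ?P = "poly_ring L"
  interpret P: domain ?P using univ_poly_is_domain[OF carrier_is_subring] .
  define f where "f = X [^]\<^bsub>?P\<^esub> m \<ominus>\<^bsub>?P\<^esub> \<one>\<^bsub>?P\<^esub>"
  have Xc: "X \<in> carrier ?P" using var_closed(1)[OF carrier_is_subring] .
  have fc: "f \<in> carrier ?P" unfolding f_def using Xc by simp
  have hom: "ring_hom_cring ?P L (\<lambda>p. eval p a)" if "a \<in> carrier L" for a
    using eval_cring_hom[OF carrier_is_subring that] .
  have f_eval: "eval f a = a [^] m \<ominus> \<one>" if a: "a \<in> carrier L" for a
  proof -
    interpret h: ring_hom_cring ?P L "\<lambda>p. eval p a" using hom[OF a] .
    show ?thesis using Xc unfolding f_def a_minus_def
      by (simp add: h.hom_power eval_var[OF a] del: h.hom_one) (use h.hom_one in simp)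
  qed
  have Xm: "X [^]\<^bsub>?P\<^esub> m = monom \<one> m" using unitary_monom_eq_var_pow[OF carrier_is_subring] by simp
  have one: "\<ominus>\<^bsub>?P\<^esub> \<one>\<^bsub>?P\<^esub> = [\<ominus> \<one>]"
    using univ_poly_a_inv_def'[OF carrier_is_subring, of "\<one>\<^bsub>?P\<^esub>"] P.one_closed 
    by (simp add: univ_poly_one)
  have deg: "degree f = m"
  proof -
    have "degree f = max (degree (X [^]\<^bsub>?P\<^esub> m)) (degree [\<ominus> \<one>])"
      unfolding f_def a_minus_def one
      using Xm mk by (intro poly_add_degree_eq[OF carrier_is_subring, folded univ_poly_add[of L "carrier L"]])
        (auto simp: monom_def polynomial_def split: if_splits)
    then show ?thesis unfolding Xm monom_def by simp
  qed
  have fn: "f \<noteq> []" using deg mk by auto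
  \<comment> \<open>A multiple root \<open>a\<close> would also be a root of the cofactor of \<open>X - a\<close>, whose value at \<open>a\<close> is \<open>m\<close> times a power of \<open>a\<close>.\<close>
  have mult: "alg_mult f a \<le> 1" for a
  proof (rule ccontr)
    assume "\<not> ?thesis"
    then have 2: "2 \<le> alg_mult f a" by simp
    then have ac: "a \<in> carrier L" unfolding alg_mult_def by (auto split: if_splits)
    have "is_root f a" using iffD1[OF alg_mult_gt_zero_iff_is_root[OF fc, of a]] 2 by linarith
    then have am: "a [^] m = \<one>" unfolding is_root_def f_eval[OF ac] using ac by simp
    have an: "a \<noteq> \<zero>" using am mk ac by (auto simp: nat_pow_zero)
    interpret h: ring_hom_cring ?P L "\<lambda>p. eval p a" using hom[OF ac] .
    let ?d = "[\<one>, \<ominus> a]"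
    have Ac: "[a] \<in> carrier ?P" using an ac by (simp add: univ_poly_def polynomial_def)
    have dc: "?d \<in> carrier ?P" using ac by (simp add: univ_poly_def polynomial_def)
    have d: "X \<ominus>\<^bsub>?P\<^esub> [a] = ?d"
    proof -
      have "\<ominus>\<^bsub>?P\<^esub> [a] = [\<ominus> a]" using univ_poly_a_inv_def'[OF carrier_is_subring Ac] by simp
      then show ?thesis unfolding a_minus_def var_def using ac by (simp add: univ_poly_add)
    qed
    have Am: "[a] [^]\<^bsub>?P\<^esub> m = \<one>\<^bsub>?P\<^esub>"
    proof -
      have "[a] [^]\<^bsub>?P\<^esub> j = [a [^] j]" for j :: nat
      proof (induction j)
        case (Suc j)
        have "a [^] j \<otimes> a \<noteq> \<zero>" using an ac by (simp add: integral_iff power_nonzero)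
        then show ?case using Suc ac an by (simp add: univ_poly_mult)
      qed (simp add: univ_poly_one)
      then show ?thesis using am by (simp add: univ_poly_one)
    qed
    have "\<exists>g\<in>carrier ?P. X [^]\<^bsub>?P\<^esub> Suc k \<ominus>\<^bsub>?P\<^esub> [a] [^]\<^bsub>?P\<^esub> Suc k = (X \<ominus>\<^bsub>?P\<^esub> [a]) \<otimes>\<^bsub>?P\<^esub> g
        \<and> eval g a = add_pow L (Suc k) (eval [a] a [^] k)"
      using ac by (intro h.power_diff_factor[OF Xc Ac]) (simp add: eval_var)
    then obtain g where g: "g \<in> carrier ?P" "f = ?d \<otimes>\<^bsub>?P\<^esub> g" "eval g a = add_pow L m (a [^] k)"
      unfolding mk[symmetric] Am d f_def[symmetric] using ac by auto
    have "?d [^]\<^bsub>?P\<^esub> (2::nat) pdivides f"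
      using le_alg_mult_imp_pdivides[OF ac fc 2] .
    then obtain e where e: "e \<in> carrier ?P" "f = ?d [^]\<^bsub>?P\<^esub> (2::nat) \<otimes>\<^bsub>?P\<^esub> e"
      unfolding pdivides_def factor_def by blast
    have "?d \<otimes>\<^bsub>?P\<^esub> g = ?d \<otimes>\<^bsub>?P\<^esub> (?d \<otimes>\<^bsub>?P\<^esub> e)"
      using e g dc by (simp add: numeral_2_eq_2 P.m_assoc)
    then have "g = ?d \<otimes>\<^bsub>?P\<^esub> e"
      using P.m_lcancel[OF _ dc g(1), of "?d \<otimes>\<^bsub>?P\<^esub> e"] dc e(1) by (simp add: univ_poly_zero)
    then have "eval g a = eval ?d a \<otimes> eval e a" using dc e(1) by (simp only: h.hom_mult)
    moreover have "eval ?d a = \<zero>" using ac by (simp add: r_neg)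
    moreover have "eval e a \<in> carrier L" using e(1) by (rule h.hom_closed)
    ultimately have "add_pow L m (a [^] k) = \<zero>" using g(3) by simp
    then have "add_pow L m \<one> \<otimes> a [^] k = \<zero>" using ac by (subst add_pow_ldistr) auto
    then show False using m ac an by (simp add: integral_iff power_nonzero)
  qed
  have count: "count (roots f) = alg_mult f" using alg_mult_eq_count_roots[OF fc] by simp
  have set: "set_mset (roots f) = {x \<in> carrier L. x [^] m = \<one>}"
    using roots_mem_iff_is_root[OF fc] fn f_eval unfolding is_root_def by auto
  have "size (roots f) = card (set_mset (roots f))"
    unfolding size_multiset_overloaded_eq
  proof (subst card_eq_sum, rule sum.cong)
    fix x assume "x \<in># roots f"
    then have "0 < alg_mult f x" using count by (metis count_greater_zero_iff)
    then show "count (roots f) x = 1" using mult[of x] count by simp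
  qed simp
  moreover have "size (roots f) = m"
    using roots_over_carrier[OF fc] deg unfolding splitted_def by simp
  ultimately show ?thesis using set by simp
qed

text \<open>The witness is the algebraic closure of the integers modulo \<open>p\<close>; the
  element type is the one \<open>alg_closure\<close> has over \<open>int\<close>.\<close>

lemma exists_algebraically_closed_field_char:
  assumes "Factorial_Ring.prime (p :: nat)"
  shows "\<exists>L :: ((int list \<times> nat) multiset \<Rightarrow> int) ring. algebraically_closed L \<and> add_pow L p \<one>\<^bsub>L\<^esub> = \<zero>\<^bsub>L\<^esub>"
proof -
  define R where "R = residue_ring (int p)"
  interpret residues_prime p R by unfold_locales (use assms R_def in auto)
  define L where "L = alg_closure"
  have "algebraic_closure L (indexed_const ` carrier R)" and hom: "indexed_const \<in> ring_hom R L"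
    unfolding L_def by (rule alg_closureE)+
  then interpret L: algebraic_closure L "indexed_const ` carrier R" by simp
  have "add_pow R n \<one>\<^bsub>R\<^esub> = int n mod int p" for n
    by (induction n) (auto simp: res_zero_eq res_add_eq res_one_eq mod_simps add.commute)
  then have 0: "add_pow R p \<one>\<^bsub>R\<^esub> = \<zero>\<^bsub>R\<^esub>" by (simp add: res_zero_eq)
  interpret h: ring_hom_ring R L indexed_const
    using ring_hom_ringI2[OF ring_axioms L.ring_axioms hom] .
  have "indexed_const (add_pow R n \<one>\<^bsub>R\<^esub>) = add_pow L n \<one>\<^bsub>L\<^esub>" for n :: nat
    by (induction n) auto
  then have "add_pow L p \<one>\<^bsub>L\<^esub> = \<zero>\<^bsub>L\<^esub>" using 0 by (metis h.hom_zero)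
  then show ?thesis using L.algebraically_closed_axioms by blast
qed

section \<open>Quadratic characters and the Paley colouring\<close>

locale paley_field = algebraically_closed L for L (structure) +
  fixes p k s :: nat
  assumes prime: "Factorial_Ring.prime p" and char: "add_pow L p \<one> = \<zero>"
    and order: "p ^ k = 4 * s + 1" and s_pos: "s > 0"
begin

definition F :: "'a set" where
  "F = {x \<in> carrier L. x [^] (4 * s + 1) = x}"

text \<open>Euler's criterion taken as the definition, with \<open>2 * s\<close> being half of
  \<open>4 * s\<close>, the order of the multiplicative group of \<open>F\<close>. Multiplicativity
  is thereby inherited from powers.\<close>

definition quad_char :: "'a \<Rightarrow> int" where
  "quad_char x = (if x = \<zero> then 0 else if x [^] (2 * s) = \<one> then 1 else -1)"

lemma F_carrier: "x \<in> F \<Longrightarrow> x \<in> carrier L"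
  by (simp add: F_def)

lemma F_eq: "F = insert \<zero> {x \<in> carrier L. x [^] (4 * s) = \<one>}"
proof -
  have "x [^] (4 * s + 1) = x \<longleftrightarrow> x = \<zero> \<or> x [^] (4 * s) = \<one>" if x: "x \<in> carrier L" for x
  proof -
    have "x [^] (4 * s + 1) = x \<longleftrightarrow> x [^] (4 * s) \<otimes> x = \<one> \<otimes> x" using x by simp
    also have "\<dots> \<longleftrightarrow> x = \<zero> \<or> x [^] (4 * s) = \<one>"
      using x by (metis m_rcancel nat_pow_closed one_closed r_null)
    finally show ?thesis .
  qed
  then show ?thesis unfolding F_def by auto
qed

text \<open>As \<open>p\<close> divides \<open>4 * s + 1\<close>, the multiple \<open>4 * s\<close>
  of \<open>\<one>\<close> is \<open>\<ominus> \<one>\<close>; it is also twice the multiple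
  \<open>2 * s\<close>.\<close>

lemma add_pow_nonzero: "add_pow L (4 * s) \<one> \<noteq> \<zero>" "add_pow L (2 * s) \<one> \<noteq> \<zero>"
proof -
  have "k > 0" using order s_pos by (cases k) auto
  then have "p dvd 4 * s + 1" using order by (metis dvd_power)
  then obtain c where c: "4 * s + 1 = p * c" by blast
  have "add_pow L (4 * s + 1) \<one> = add_pow L c (add_pow L p \<one>)"
    unfolding c by (simp add: add.nat_pow_pow)
  also have "\<dots> = \<zero>" by (simp add: char)
  finally have "add_pow L (4 * s) \<one> \<oplus> \<one> = \<zero>" by simp
  then show 1: "add_pow L (4 * s) \<one> \<noteq> \<zero>" by auto
  have "add_pow L (4 * s) \<one> = add_pow L (2 * s) \<one> \<oplus> add_pow L (2 * s) \<one>"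
    by (simp add: add.nat_pow_mult)
  with 1 show "add_pow L (2 * s) \<one> \<noteq> \<zero>" by auto
qed

lemma zero_notin: "\<zero> [^] (4 * s) \<noteq> \<one>" "\<zero> [^] (2 * s) \<noteq> \<one>"
  using s_pos by (auto simp: nat_pow_zero)

lemma card_units: "card {x \<in> carrier L. x [^] (4 * s) = \<one>} = 4 * s"
  "card {x \<in> carrier L. x [^] (2 * s) = \<one>} = 2 * s"
  using card_roots_of_unity add_pow_nonzero by auto

lemma finite_F: "finite F" and card_F: "card F = 4 * s + 1"
proof -
  have "finite {x \<in> carrier L. x [^] (4 * s) = \<one>}" using card_units(1) s_pos by (intro card_ge_0_finite) simp
  then show "finite F" "card F = 4 * s + 1" unfolding F_eq using card_units zero_notin by auto
qed

lemma F_mult: "x \<in> F \<Longrightarrow> y \<in> F \<Longrightarrow> x \<otimes> y \<in> F"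
  by (simp only: F_def mem_Collect_eq nat_pow_distrib m_closed)

lemma even_power_minus: "x \<in> carrier L \<Longrightarrow> (\<ominus> x) [^] (2 * m) = x [^] (2 * m)" for m :: nat
proof -
  assume x: "x \<in> carrier L"
  have "(\<ominus> x) [^] (2::nat) = x [^] (2::nat)" using x by (simp add: numeral_2_eq_2 l_minus r_minus)
  then show ?thesis using x by (metis nat_pow_pow a_inv_closed)
qed

lemma F_minus: "x \<in> F \<Longrightarrow> \<ominus> x \<in> F"
proof -
  assume x: "x \<in> F"
  have "(\<ominus> x) [^] (4 * s) = x [^] (4 * s)"
    using even_power_minus[of x "2 * s"] F_carrier[OF x] by simp
  then show ?thesis using x zero_notin unfolding F_eq by auto
qed

lemma F_inverse: 
  assumes "x \<in> F" "x \<noteq> \<zero>"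
  shows "inv x \<in> F" "inv x \<noteq> \<zero>"
proof -
  have u: "x \<in> Units L" using assms F_carrier field_Units by auto
  then have "x [^] (4 * s) \<otimes> (inv x) [^] (4 * s) = \<one>"
    by (subst nat_pow_distrib[symmetric]) auto
  then show "inv x \<in> F" using assms u unfolding F_eq by auto
  show "inv x \<noteq> \<zero>" using u by (metis Units_inv_closed Units_r_inv Units_closed r_null zero_not_one)
qed

lemma F_zero: "\<zero> \<in> F" and F_one: "\<one> \<in> F"
  unfolding F_eq by auto

text \<open>The exponent \<open>4 * s + 1\<close> is the power \<open>p ^ k\<close>, so raising to
  it is an iterated Frobenius map.\<close>

lemma F_one_add: "x \<in> F \<Longrightarrow> \<one> \<oplus> x \<in> F"
  unfolding F_def using frobenius_iterated[OF prime char, of x k] order by auto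

lemma F_add: "x \<in> F \<Longrightarrow> y \<in> F \<Longrightarrow> x \<oplus> y \<in> F"
proof (cases "x = \<zero>")
  case False
  assume x: "x \<in> F" and y: "y \<in> F"
  have u: "x \<in> Units L" using x False F_carrier field_Units by auto
  have "x \<oplus> y = x \<otimes> (\<one> \<oplus> inv x \<otimes> y)"
  proof -
    have "x \<otimes> (\<one> \<oplus> inv x \<otimes> y) = x \<oplus> (x \<otimes> inv x) \<otimes> y"
      using x y F_carrier u by (simp add: r_distr m_assoc del: Units_r_inv)
    then show ?thesis using u y F_carrier by simp
  qed
  then show ?thesis using x y F_mult F_one_add F_inverse False by simp
qed (use F_carrier in simp)

lemma F_diff: "x \<in> F \<Longrightarrow> y \<in> F \<Longrightarrow> x \<ominus> y \<in> F"
  unfolding a_minus_def by (intro F_add F_minus)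

lemma half_power:
  assumes "x \<in> F" "x \<noteq> \<zero>" "x [^] (2 * s) \<noteq> \<one>"
  shows "x [^] (2 * s) = \<ominus> \<one>"
proof -
  let ?y = "x [^] (2 * s)"
  have y: "?y \<in> carrier L" using assms F_carrier by simp
  have "?y \<otimes> ?y = x [^] (4 * s)" using assms F_carrier by (simp add: nat_pow_mult)
  then have "?y \<otimes> ?y = \<one>" using assms F_eq by simp
  then have "(?y \<ominus> \<one>) \<otimes> (?y \<oplus> \<one>) = \<zero>" using y by algebra
  then have "?y \<ominus> \<one> = \<zero> \<or> ?y \<oplus> \<one> = \<zero>" using y by (simp add: integral_iff)
  then show ?thesis using y assms(3) by (metis minus_equality one_closed r_right_minus_eq)
qed

lemma minus_one_neq_one: "\<ominus> \<one> \<noteq> \<one>"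
proof
  assume "\<ominus> \<one> = \<one>"
  then have "\<one> \<oplus> \<one> = \<zero>" by (metis one_closed r_neg)
  then have "add_pow L (2::nat) \<one> = \<zero>" by (simp add: numeral_2_eq_2)
  then have "add_pow L s (add_pow L (2::nat) \<one>) = \<zero>" by simp
  then show False using add_pow_nonzero(2) by (simp add: add.nat_pow_pow)
qed

lemma quad_char_mult:
  assumes "x \<in> F" "y \<in> F"
  shows "quad_char (x \<otimes> y) = quad_char x * quad_char y"
proof (cases "x = \<zero> \<or> y = \<zero>")
  case True
  then show ?thesis using assms F_carrier unfolding quad_char_def by auto
next
  case False
  have "(x \<otimes> y) [^] (2 * s) = x [^] (2 * s) \<otimes> y [^] (2 * s)"
    using assms F_carrier by (simp add: nat_pow_distrib)
  then show ?thesis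
    using False assms half_power[of x] half_power[of y] F_carrier minus_one_neq_one
    unfolding quad_char_def by (auto simp: integral_iff l_minus)
qed

text \<open>The exponent \<open>2 * s\<close> is even, which is where a field order congruent to 1
  modulo 4 matters. It makes the colouring by differences symmetric.\<close>

lemma quad_char_minus: "x \<in> carrier L \<Longrightarrow> quad_char (\<ominus> x) = quad_char x"
  unfolding quad_char_def using even_power_minus[of x s] by auto

lemma quad_char_diff_commute:
  assumes "x \<in> F" "y \<in> F"
  shows "quad_char (x \<ominus> y) = quad_char (y \<ominus> x)"
proof -
  have "x \<ominus> y = \<ominus> (y \<ominus> x)" using assms F_carrier by (metis minus_minus minus_add a_minus_def a_comm a_inv_closed)
  then show ?thesis using quad_char_minus assms F_carrier by simp
qed

lemma quad_char_square:
  assumes "x \<in> F" "x \<noteq> \<zero>"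
  shows "quad_char x * quad_char x = 1"
  using assms unfolding quad_char_def by auto

text \<open>Of the \<open>4 * s\<close> nonzero elements exactly \<open>2 * s\<close> satisfy
  \<open>x [^] (2 * s) = \<one>\<close>, so the two signs balance.\<close>

lemma sum_quad_char: "(\<Sum>x\<in>F. quad_char x) = 0"
proof -
  let ?S = "{x \<in> carrier L. x [^] (2 * s) = \<one>}"
  have SF: "?S \<subseteq> F - {\<zero>}"
  proof
    fix x assume x: "x \<in> ?S"
    then have "x [^] (2 * s) \<otimes> x [^] (2 * s) = x [^] (4 * s)" by (subst nat_pow_mult) auto
    then show "x \<in> F - {\<zero>}" using x zero_notin unfolding F_eq by auto
  qed
  have "(\<Sum>x\<in>F. quad_char x) = (\<Sum>x\<in>F - {\<zero>}. quad_char x)"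
    using finite_F F_zero by (simp add: sum.remove quad_char_def)
  also have "\<dots> = (\<Sum>x\<in>F - {\<zero>}. if x \<in> ?S then 1 else -1)"
    using F_carrier by (intro sum.cong) (auto simp: quad_char_def)
  also have "\<dots> = int (card ?S) - int (card (F - {\<zero>} - ?S))"
    using finite_F SF by (subst sum.If_cases) (auto simp: Int_absorb1 Diff_eq)
  also have "card (F - {\<zero>} - ?S) = card (F - {\<zero>}) - card ?S"
    using SF finite_F by (intro card_Diff_subset) (auto intro: finite_subset)
  finally show ?thesis using card_units(2) card_F F_zero by simp
qed

lemma sum_quad_char_shift:
  assumes "x \<in> F"
  shows "(\<Sum>b\<in>F. quad_char (b \<ominus> x)) = 0"
proof -
  have "(\<Sum>b\<in>F. quad_char (b \<ominus> x)) = (\<Sum>b\<in>F. quad_char b)"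
    using assms F_diff F_add F_carrier
    by (intro sum.reindex_bij_witness[of _ "\<lambda>b. b \<oplus> x" "\<lambda>b. b \<ominus> x"])
      (auto simp: a_minus_def a_assoc l_neg r_neg)
  then show ?thesis using sum_quad_char by simp
qed

lemma mult_inv_mult_inv:
  assumes "d \<in> Units L" "b \<in> Units L"
  shows "d \<otimes> inv (d \<otimes> inv b) = b"
proof -
  let ?c = "d \<otimes> inv b"
  have c: "?c \<in> Units L" using assms by simp
  have "?c \<otimes> b = d \<otimes> (inv b \<otimes> b)" using assms by (intro m_assoc) auto
  then have "d = b \<otimes> ?c" using assms c by (simp add: m_comm Units_closed)
  then have "d \<otimes> inv ?c = (b \<otimes> ?c) \<otimes> inv ?c" by (rule arg_cong)
  also have "\<dots> = b \<otimes> (?c \<otimes> inv ?c)" using assms c by (intro m_assoc) auto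
  also have "\<dots> = b" using assms c by (simp add: Units_closed)
  finally show ?thesis .
qed

lemma sum_quad_char_product:
  assumes d: "d \<in> F" "d \<noteq> \<zero>"
  shows "(\<Sum>b\<in>F. quad_char b * quad_char (b \<oplus> d)) = -1"
proof -
  have "(\<Sum>b\<in>F. quad_char b * quad_char (b \<oplus> d)) = (\<Sum>b\<in>F-{\<zero>}. quad_char b * quad_char (b \<oplus> d))"
    using finite_F F_zero by (simp add: sum.remove quad_char_def)
  \<comment> \<open>\<open>quad_char b * quad_char (b + d) = quad_char (1 + d / b)\<close>, and \<open>1 + d / b\<close> runs through \<open>F - {1}\<close>\<close>
  also have "\<dots> = (\<Sum>z\<in>F - {\<one>}. quad_char z)"
  proof (rule sum.reindex_bij_witness[of _ "\<lambda>z. d \<otimes> inv (z \<ominus> \<one>)" "\<lambda>b. \<one> \<oplus> d \<otimes> inv b"])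
    fix b assume b: "b \<in> F - {\<zero>}"
    have bu: "b \<in> Units L" "b \<in> carrier L" using b F_carrier field_Units by auto
    have du: "d \<in> Units L" "d \<in> carrier L" using d F_carrier field_Units by auto
    have ic: "inv b \<in> carrier L" "inv d \<in> carrier L" "inv b \<in> Units L" using bu du by auto
    have nz: "d \<otimes> inv b \<noteq> \<zero>" using du ic F_inverse b d by (simp add: integral_iff)
    have "(\<one> \<oplus> d \<otimes> inv b) \<ominus> \<one> = d \<otimes> inv b" using du ic by algebra
    moreover have "d \<otimes> inv (d \<otimes> inv b) = b"
      using mult_inv_mult_inv du bu by simp
    ultimately show "d \<otimes> inv ((\<one> \<oplus> d \<otimes> inv b) \<ominus> \<one>) = b" by simp
    have "\<one> \<oplus> d \<otimes> inv b \<noteq> \<one>" using nz du ic by (metis \<open>(\<one> \<oplus> d \<otimes> inv b) \<ominus> \<one> = d \<otimes> inv b\<close> one_closed r_right_minus_eq)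
    moreover have "\<one> \<oplus> d \<otimes> inv b \<in> F" using F_one_add F_mult F_inverse b d by simp
    ultimately show "\<one> \<oplus> d \<otimes> inv b \<in> F - {\<one>}" by simp
    have "b \<otimes> (\<one> \<oplus> d \<otimes> inv b) = b \<oplus> d"
    proof -
      have "b \<otimes> (\<one> \<oplus> d \<otimes> inv b) = b \<oplus> d \<otimes> (b \<otimes> inv b)" using bu(2) du(2) ic(1) by algebra
      then show ?thesis using bu du by simp
    qed
    then have "quad_char (b \<oplus> d) = quad_char b * quad_char (\<one> \<oplus> d \<otimes> inv b)"
      using quad_char_mult[of b "\<one> \<oplus> d \<otimes> inv b"] b \<open>\<one> \<oplus> d \<otimes> inv b \<in> F\<close> by simp
    then show "quad_char (\<one> \<oplus> d \<otimes> inv b) = quad_char b * quad_char (b \<oplus> d)"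
      using quad_char_square[of b] b by (simp add: mult.assoc[symmetric])
  next
    fix z assume z: "z \<in> F - {\<one>}"
    let ?w = "z \<ominus> \<one>"
    have w: "?w \<in> F" using z F_diff F_one by simp
    have wn: "?w \<noteq> \<zero>" using z F_carrier by (metis DiffD1 DiffD2 one_closed r_right_minus_eq singletonI)
    have wu: "?w \<in> Units L" "?w \<in> carrier L" using w wn F_carrier field_Units by auto
    have du: "d \<in> Units L" "d \<in> carrier L" using d F_carrier field_Units by auto
    have ic: "inv ?w \<in> carrier L" "inv d \<in> carrier L" "inv ?w \<in> Units L" using wu du by auto
    have "d \<otimes> inv (d \<otimes> inv ?w) = ?w"
      using mult_inv_mult_inv du wu by simp
    moreover have "\<one> \<oplus> ?w = z" using z F_carrier by (metis DiffD1 a_comm a_inv_closed a_minus_def add.inv_solve_right' one_closed minus_closed)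
    ultimately show "\<one> \<oplus> d \<otimes> inv (d \<otimes> inv ?w) = z" by simp
    have "d \<otimes> inv ?w \<noteq> \<zero>" using du ic F_inverse w wn d by (simp add: integral_iff)
    then show "d \<otimes> inv ?w \<in> F - {\<zero>}" using F_mult F_inverse w wn d by simp
  qed
  also have "\<dots> = (\<Sum>z\<in>F. quad_char z) - quad_char \<one>"
    using finite_F F_one by (simp add: sum_diff1)
  also have "\<dots> = -1" using sum_quad_char by (simp add: quad_char_def)
  finally show ?thesis .
qed

lemma card_distinguish:
  assumes xy: "x \<in> F" "y \<in> F" "x \<noteq> y" and e: "e = 1 \<or> e = -1"
  shows "card {b \<in> F - {x, y}. quad_char (b \<ominus> x) = - e \<and> quad_char (b \<ominus> y) = e} = s"
proof -
  let ?A = "F - {x, y}" and ?f = "\<lambda>b. quad_char (b \<ominus> x)" and ?g = "\<lambda>b. quad_char (b \<ominus> y)"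
  have pm: "quad_char (b \<ominus> z) = 1 \<or> quad_char (b \<ominus> z) = -1" if "b \<in> F" "z \<in> F" "b \<noteq> z" for b z
    using that F_carrier r_right_minus_eq unfolding quad_char_def by auto
  have self: "quad_char (z \<ominus> z) = 0" if "z \<in> F" for z
    using that F_carrier unfolding quad_char_def by (simp add: a_minus_def r_neg)
  have split: "sum h F = sum h ?A + h x + h y" for h :: "'a \<Rightarrow> int"
  proof -
    have "sum h F = h x + (h y + sum h (F - {x} - {y}))"
      using finite_F xy by (subst sum.remove[of F x], simp, simp, subst sum.remove[of "F - {x}" y]) auto
    then show ?thesis by (simp add: set_diff_eq conj_commute conj_left_commute ac_simps)
  qed
  have prod: "(\<Sum>b\<in>F. ?f b * ?g b) = -1"
  proof -
    let ?d = "x \<ominus> y"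
    have d: "?d \<in> F" "?d \<noteq> \<zero>" using xy F_diff F_carrier r_right_minus_eq by auto
    have "(\<Sum>b\<in>F. ?f b * ?g b) = (\<Sum>b\<in>F. quad_char b * quad_char (b \<oplus> ?d))"
    proof (rule sum.reindex_bij_witness[of _ "\<lambda>b. b \<oplus> x" "\<lambda>b. b \<ominus> x"])
      fix b assume b: "b \<in> F"
      have c: "b \<in> carrier L" "x \<in> carrier L" "y \<in> carrier L" using b xy F_carrier by auto
      show "b \<ominus> x \<oplus> x = b" "b \<oplus> x \<ominus> x = b" using c by algebra+
      show "b \<ominus> x \<in> F" "b \<oplus> x \<in> F" using b xy F_add F_diff by auto
      have "b \<ominus> x \<oplus> ?d = b \<ominus> y" using c by algebra
      then show "quad_char (b \<ominus> x) * quad_char (b \<ominus> x \<oplus> ?d) = ?f b * ?g b" by simp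
    qed
    then show ?thesis using sum_quad_char_product[OF d] by simp
  qed
  have f: "sum ?f ?A = - quad_char (y \<ominus> x)" and g: "sum ?g ?A = - quad_char (x \<ominus> y)"
    and fg: "(\<Sum>b\<in>?A. ?f b * ?g b) = -1"
    using split[of ?f] split[of ?g] split[of "\<lambda>b. ?f b * ?g b"] self xy prod
      sum_quad_char_shift[of x] sum_quad_char_shift[of y] by auto
  have A: "card ?A = 4 * s - 1" using xy finite_F card_F by (simp add: card_Diff_subset)
  let ?N = "{b \<in> ?A. ?f b = - e \<and> ?g b = e}"
  have "4 * int (card ?N) = (\<Sum>b\<in>?A. if ?f b = - e \<and> ?g b = e then 4 else 0)"
    using finite_F by (simp add: sum.If_cases Int_def)
  \<comment> \<open>On values 1 and -1 the indicator of the pattern is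
    \<open>(1 - e * f) * (1 + e * g) / 4\<close>, expanded with \<open>e * e = 1\<close>.\<close>
  also have "\<dots> = (\<Sum>b\<in>?A. 1 - e * ?f b + e * ?g b - ?f b * ?g b)"
  proof (rule sum.cong)
    fix b assume "b \<in> ?A"
    then have "?f b = 1 \<or> ?f b = -1" "?g b = 1 \<or> ?g b = -1" using pm xy by auto
    then show "(if ?f b = - e \<and> ?g b = e then 4 else 0) = 1 - e * ?f b + e * ?g b - ?f b * ?g b"
      using e by auto
  qed simp
  also have "\<dots> = int (card ?A) - e * sum ?f ?A + e * sum ?g ?A - (\<Sum>b\<in>?A. ?f b * ?g b)"
    by (simp add: sum_subtractf sum.distrib sum_distrib_left)
  \<comment> \<open>The linear terms cancel because \<open>quad_char\<close> is symmetric in the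
    difference; what is left is \<open>(4 * s - 1) + 1\<close>.\<close>
  also have "\<dots> = 4 * int s"
    unfolding f g fg A using quad_char_diff_commute[OF xy(1,2)] s_pos by simp
  finally show ?thesis by simp
qed

end

lemma paley_colouring_exists:
  assumes "primepow (4 * s + 1 :: nat)"
  shows "\<exists>R :: nat \<Rightarrow> nat \<Rightarrow> bool. (\<forall>x y. R x y = R y x) \<and>
    (\<forall>x<4 * s + 1. \<forall>y<4 * s + 1. x \<noteq> y \<longrightarrow> (\<forall>a. card {b \<in> {..<4 * s + 1} - {x, y}. R b x \<noteq> a \<and> R b y = a} = s))"
proof -
  obtain p k where pk: "Factorial_Ring.prime p" "k > 0" "4 * s + 1 = p ^ k"
    using assms unfolding primepow_def by (metis)
  have s: "s > 0"
  proof (rule ccontr)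
    assume "\<not> s > 0"
    then have "p ^ k = 1" using pk by simp
    then show False using pk prime_gt_1_nat[of p] by simp
  qed
  obtain L :: "((int list \<times> nat) multiset \<Rightarrow> int) ring" where L: "algebraically_closed L" "add_pow L p \<one>\<^bsub>L\<^esub> = \<zero>\<^bsub>L\<^esub>"
    using exists_algebraically_closed_field_char[OF pk(1)] by blast
  interpret paley_field L p k s
    using L pk s by (simp add: paley_field_def paley_field_axioms_def)
  let ?q = "4 * s + 1"
  obtain h where h: "bij_betw h {..<?q} F"
    using finite_F card_F by (metis card_lessThan finite_lessThan finite_same_card_bij)
  \<comment> \<open>The bounds make \<open>R\<close> false outside the range, so symmetry holds for
    all natural numbers.\<close>
  define R where "R x y \<longleftrightarrow> (x < ?q \<and> y < ?q \<and> quad_char (h x \<ominus>\<^bsub>L\<^esub> h y) = 1)" for x y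
  have hF: "h x \<in> F" if "x < ?q" for x using h that by (auto simp: bij_betw_def)
  have sym: "R x y = R y x" for x y
    unfolding R_def using quad_char_diff_commute[of "h x" "h y"] hF by auto
  have "card {b \<in> {..<?q} - {x, y}. R b x \<noteq> a \<and> R b y = a} = s"
    if xy: "x < ?q" "y < ?q" "x \<noteq> y" for x y a
  proof -
    define e :: int where "e = (if a then 1 else -1)"
    have hxy: "h x \<noteq> h y" using xy h by (auto simp: bij_betw_def inj_on_def)
    have pm: "quad_char (u \<ominus>\<^bsub>L\<^esub> v) = 1 \<or> quad_char (u \<ominus>\<^bsub>L\<^esub> v) = -1" if "u \<in> F" "v \<in> F" "u \<noteq> v" for u v
      using that F_carrier r_right_minus_eq unfolding quad_char_def by auto
    have "bij_betw h {b \<in> {..<?q} - {x, y}. R b x \<noteq> a \<and> R b y = a}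
       {b \<in> F - {h x, h y}. quad_char (b \<ominus>\<^bsub>L\<^esub> h x) = - e \<and> quad_char (b \<ominus>\<^bsub>L\<^esub> h y) = e}"
      (is "bij_betw h ?A ?B")
    proof (rule bij_betw_subset[OF h, THEN bij_betw_cong[THEN iffD1, rotated]])
      show "?A \<subseteq> {..<?q}" by auto
      have eq: "b \<in> ?A \<longleftrightarrow> h b \<in> ?B" if b: "b < ?q" for b
      proof (cases "b = x \<or> b = y")
        case False
        then have n: "h b \<noteq> h x" "h b \<noteq> h y" using b xy h by (auto simp: bij_betw_def inj_on_def)
        show ?thesis
          using False n b xy hF[OF b] hF[OF xy(1)] hF[OF xy(2)] pm[of "h b" "h x"] pm[of "h b" "h y"]
          unfolding R_def e_def by auto
      qed auto
      show "h ` ?A = ?B"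
      proof
        show "h ` ?A \<subseteq> ?B" using eq by auto
        show "?B \<subseteq> h ` ?A"
        proof
          fix u assume u: "u \<in> ?B"
          then obtain b where "b < ?q" "u = h b" using h by (auto simp: bij_betw_def)
          then show "u \<in> h ` ?A" using eq u by blast
        qed
      qed
    qed simp
    from bij_betw_same_card[OF this] show ?thesis
      using card_distinguish[OF hF[OF xy(1)] hF[OF xy(2)] hxy, of e] unfolding e_def by auto
  qed
  with sym show ?thesis by blast
qed

section \<open>Orderable copies of complete bipartite graphs\<close>

lemma exists_sorted_enumeration:
  fixes pos :: "'a \<Rightarrow> nat"
  assumes "finite A" "inj_on pos A"
  shows "\<exists>xs. set xs = A \<and> distinct xs \<and> sorted_wrt (\<lambda>x y. pos x < pos y) xs"
proof -
  obtain ys where ys: "set ys = A" "distinct ys" using finite_distinct_list[OF assms(1)] by blast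
  let ?xs = "sort_key pos ys"
  have "distinct (map pos ?xs)" using ys assms(2) by (simp add: distinct_map)
  then have "sorted_wrt (<) (map pos ?xs)" using sorted_sort_key[of pos ys] strict_sorted_iff by blast
  then show ?thesis using ys by (intro exI[of _ ?xs]) (simp add: sorted_wrt_map)
qed

text \<open>Positions and a colour function are easier to build than lists when vertices are
  inserted between others. The colour of the last vertex is unconstrained, matching the shorter
  colour list.\<close>

lemma orderable_iff:
  assumes "finite (verts G)"
  shows "orderable G \<chi> \<longleftrightarrow> (\<exists>(pos :: _ \<Rightarrow> nat) col. inj_on pos (verts G) \<and>
    (\<forall>u\<in>verts G. \<forall>v\<in>verts G. pos u < pos v \<and> {u, v} \<in> edges G \<longrightarrow> \<chi> {u, v} = col u))"
proof
  assume "orderable G \<chi>"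
  then obtain vs cs where o: "distinct vs" "set vs = verts G" 
    and c: "\<And>i j. i < j \<Longrightarrow> j < length vs \<Longrightarrow> {vs ! i, vs ! j} \<in> edges G \<Longrightarrow> \<chi> {vs ! i, vs ! j} = cs ! i"
    unfolding orderable_def by blast
  define pos where "pos v = (THE i. i < length vs \<and> vs ! i = v)" for v
  have pos: "pos v < length vs" "vs ! pos v = v" if "v \<in> verts G" for v
  proof -
    have "\<exists>!i. i < length vs \<and> vs ! i = v" using that distinct_Ex1[OF o(1)] o(2) by metis
    then show "pos v < length vs" "vs ! pos v = v" unfolding pos_def by (rule theI'[THEN conjunct1], rule theI'[THEN conjunct2])
  qed
  have "inj_on pos (verts G)" using pos(2) by (metis inj_onI)
  moreover have "\<chi> {u, v} = cs ! pos u"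
    if "u \<in> verts G" "v \<in> verts G" "pos u < pos v" "{u, v} \<in> edges G" for u v
    using c[of "pos u" "pos v"] pos that by simp
  ultimately show "\<exists>(pos :: _ \<Rightarrow> nat) col. inj_on pos (verts G) \<and>
    (\<forall>u\<in>verts G. \<forall>v\<in>verts G. pos u < pos v \<and> {u, v} \<in> edges G \<longrightarrow> \<chi> {u, v} = col u)"
    by (intro exI[of _ pos] exI[of _ "\<lambda>u. cs ! pos u"]) blast
next
  assume "\<exists>(pos :: _ \<Rightarrow> nat) col. inj_on pos (verts G) \<and>
    (\<forall>u\<in>verts G. \<forall>v\<in>verts G. pos u < pos v \<and> {u, v} \<in> edges G \<longrightarrow> \<chi> {u, v} = col u)"
  then obtain pos :: "_ \<Rightarrow> nat" and col where inj: "inj_on pos (verts G)"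
    and col: "\<And>u v. u \<in> verts G \<Longrightarrow> v \<in> verts G \<Longrightarrow> pos u < pos v \<Longrightarrow> {u, v} \<in> edges G \<Longrightarrow> \<chi> {u, v} = col u"
    by blast
  obtain vs where vs: "set vs = verts G" "distinct vs" "sorted_wrt (\<lambda>x y. pos x < pos y) vs"
    using exists_sorted_enumeration[OF assms inj] by blast
  have "\<chi> {vs ! i, vs ! j} = map col (butlast vs) ! i"
    if ij: "i < j" "j < length vs" "{vs ! i, vs ! j} \<in> edges G" for i j
  proof -
    have "pos (vs ! i) < pos (vs ! j)" using ij sorted_wrt_nth_less[OF vs(3)] by simp
    moreover have "vs ! i \<in> verts G" "vs ! j \<in> verts G"
      using vs(1) ij nth_mem[of i vs] nth_mem[of j vs] by simp_all
    ultimately have "\<chi> {vs ! i, vs ! j} = col (vs ! i)" using col ij(3) by simp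
    then show ?thesis using ij by (simp add: nth_butlast)
  qed
  then show "orderable G \<chi>"
    unfolding orderable_def using vs(1,2) by (intro exI[of _ vs] exI[of _ "map col (butlast vs)"]) auto
qed

lemma edges_complete_graph: "{u, v} \<in> edges (complete_graph n) \<longleftrightarrow> u < n \<and> v < n \<and> u \<noteq> v"
  unfolding complete_graph_def by (auto simp: doubleton_eq_iff)

lemma verts_complete_graph: "verts (complete_graph n) = {..<n}"
  unfolding complete_graph_def by simp

lemma copy_complete_bipartite:
  "copy_in (complete_graph n) (complete_bipartite s t) G \<longleftrightarrow>
   (\<exists>A B. A \<subseteq> {..<n} \<and> B \<subseteq> {..<n} \<and> A \<inter> B = {} \<and> card A = s \<and> card B = t \<and>
     verts G = A \<union> B \<and> edges G = {{a, b} |a b. a \<in> A \<and> b \<in> B})" (is "_ \<longleftrightarrow> ?rhs")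
proof
  assume "copy_in (complete_graph n) (complete_bipartite s t) G"
  then obtain f where sub: "verts G \<subseteq> {..<n}"
    and f: "bij_betw f ({..<s} <+> {..<t}) (verts G)"
    and e: "edges G = (\<lambda>e. f ` e) ` {{Inl i, Inr j} |i j. i < s \<and> j < t}"
    unfolding copy_in_def subgraph_def graph_iso_def verts_complete_graph
    by (auto simp: complete_bipartite_def)
  let ?A = "(f \<circ> Inl) ` {..<s}" and ?B = "(f \<circ> Inr) ` {..<t}"
  have inj: "inj_on f ({..<s} <+> {..<t})" and im: "f ` ({..<s} <+> {..<t}) = verts G"
    using f by (auto simp: bij_betw_def)
  have "inj_on (f \<circ> Inl) {..<s}" "inj_on (f \<circ> Inr) {..<t}"
    using inj by (auto simp: inj_on_def)
  then have "card ?A = s" "card ?B = t" by (simp_all only: card_image card_lessThan)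
  moreover have "?A \<inter> ?B = {}" using inj by (auto simp: inj_on_def)
  moreover have v: "verts G = ?A \<union> ?B" unfolding im[symmetric] by (auto simp: Plus_def)
  moreover have "edges G = {{a, b} |a b. a \<in> ?A \<and> b \<in> ?B}"
    unfolding e by (auto simp: image_iff) blast
  ultimately show ?rhs using sub by (intro exI[of _ ?A] exI[of _ ?B]) auto
next
  assume ?rhs
  then obtain A B where AB: "A \<subseteq> {..<n}" "B \<subseteq> {..<n}" "A \<inter> B = {}" "card A = s" "card B = t"
     and v: "verts G = A \<union> B" and e: "edges G = {{a, b} |a b. a \<in> A \<and> b \<in> B}" by blast
  have "finite A" "finite B" using AB finite_subset by blast+
  then obtain g h where g: "bij_betw g {..<s} A" and h: "bij_betw h {..<t} B"
    using AB(4,5) by (metis card_lessThan finite_lessThan finite_same_card_bij)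
  let ?f = "case_sum g h"
  have A: "A = g ` {..<s}" and B: "B = h ` {..<t}" and inj: "inj_on g {..<s}" "inj_on h {..<t}"
    using g h by (auto simp: bij_betw_def)
  have gh: "g i \<noteq> h j" if "i < s" "j < t" for i j using AB(3) that unfolding A B by blast
  have "bij_betw ?f ({..<s} <+> {..<t}) (A \<union> B)"
  proof (rule bij_betw_imageI)
    show "inj_on ?f ({..<s} <+> {..<t})"
      using gh gh[symmetric] by (auto intro!: inj_onI dest: inj_onD[OF inj(1)] inj_onD[OF inj(2)])
    show "?f ` ({..<s} <+> {..<t}) = A \<union> B"
      unfolding A B Plus_def by (simp add: image_Un image_image)
  qed
  moreover have "edges G = (\<lambda>e. ?f ` e) ` {{Inl i, Inr j} |i j. i < s \<and> j < t}"
  proof -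
    have "(\<lambda>e. ?f ` e) ` {{Inl i, Inr j} |i j. i < s \<and> j < t} = {?f ` {Inl i, Inr j} |i j. i < s \<and> j < t}"
      by blast
    also have "\<dots> = {{g i, h j} |i j. i < s \<and> j < t}" by simp
    also have "\<dots> = edges G" unfolding e A B by blast
    finally show ?thesis by simp
  qed
  moreover have "edges G \<subseteq> edges (complete_graph n)"
    unfolding e using AB edges_complete_graph by blast
  ultimately show "copy_in (complete_graph n) (complete_bipartite s t) G"
    unfolding copy_in_def subgraph_def graph_iso_def verts_complete_graph
    using AB v by (auto simp: complete_bipartite_def)
qed

text \<open>If \<open>b\<close> precedes the head of \<open>xs\<close>, sortedness puts it before
  every entry and all its edges have its own colour; otherwise the head precedes \<open>b\<close>
  and imposes the head's colour.\<close>

lemma fits_of_positions: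
  assumes "sorted_wrt (\<lambda>x y. pos x < (pos y :: nat)) xs"
    and "\<And>a. a \<in> set xs \<Longrightarrow> pos b < pos a \<Longrightarrow> f a = col b"
    and "\<And>a. a \<in> set xs \<Longrightarrow> pos a < pos b \<Longrightarrow> f a = col a"
    and "\<And>a. a \<in> set xs \<Longrightarrow> pos a \<noteq> pos b"
  shows "fits col f xs"
  using assms
proof (induction xs)
  case (Cons x xs)
  show ?case
  proof (cases "pos b < pos x")
    case True
    then have "f y = col b" if "y \<in> set (x # xs)" for y
      using that Cons.prems(1) by (intro Cons.prems(2)) auto
    then show ?thesis by simp
  next
    case False
    then have "pos x < pos b" using Cons.prems(4)[of x] by simp
    then have "f x = col x" using Cons.prems(3) by simp
    moreover have "fits col f xs" using Cons by auto
    ultimately show ?thesis by simp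
  qed
qed simp

text \<open>The number \<open>i\<close> tells after how many entries of \<open>xs\<close> the vertex
  is inserted, and \<open>w\<close> is the colour it then receives.\<close>

lemma fits_gap:
  assumes "fits \<kappa> f xs"
  shows "\<exists>i w. (\<forall>j<i. j < length xs \<longrightarrow> f (xs ! j) = \<kappa> (xs ! j)) \<and> (\<forall>j\<ge>i. j < length xs \<longrightarrow> f (xs ! j) = w)"
  using assms
proof (induction xs)
  case (Cons x xs)
  then consider "\<forall>y\<in>set xs. f y = f x" | "f x = \<kappa> x" "fits \<kappa> f xs" by auto
  then show ?case
  proof cases
    case 1
    then have "\<forall>j\<ge>0. j < length (x # xs) \<longrightarrow> f ((x # xs) ! j) = f x"
      by (metis nth_mem set_ConsD)
    then show ?thesis by (intro exI[of _ 0] exI[of _ "f x"]) simp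
  next
    case 2
    then obtain i w where i: "\<forall>j<i. j < length xs \<longrightarrow> f (xs ! j) = \<kappa> (xs ! j)"
      "\<forall>j\<ge>i. j < length xs \<longrightarrow> f (xs ! j) = w" using Cons.IH by blast
    then show ?thesis using 2(1) by (intro exI[of _ "Suc i"] exI[of _ w]) (auto simp: nth_Cons split: nat.splits)
  qed
next
  case Nil
  show ?case by (rule exI[of _ 0], rule exI[of _ undefined], intro conjI allI impI) simp_all
qed

lemma orderable_copy_iff:
  fixes \<chi> :: "nat set \<Rightarrow> 'c"
  shows "(\<exists>G. copy_in (complete_graph n) (complete_bipartite s t) G \<and> orderable G \<chi>) \<longleftrightarrow>
   (\<exists>xs \<kappa>. distinct xs \<and> length xs = s \<and> set xs \<subseteq> {..<n} \<and>
      t \<le> card {b \<in> {..<n} - set xs. fits \<kappa> (\<lambda>a. \<chi> {b, a}) xs})" (is "?lhs \<longleftrightarrow> ?rhs")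
proof
  assume ?lhs
  then obtain G where copy: "copy_in (complete_graph n) (complete_bipartite s t) G" and o: "orderable G \<chi>"
    by (elim exE conjE)
  from copy[unfolded copy_complete_bipartite] obtain A B where AB: "A \<subseteq> {..<n}" "B \<subseteq> {..<n}" "A \<inter> B = {}" "card A = s" "card B = t"
     and v: "verts G = A \<union> B" and e: "edges G = {{a, b} |a b. a \<in> A \<and> b \<in> B}"
    by (elim exE conjE)
  have fin: "finite A" "finite B" using AB finite_subset by blast+
  have fG: "finite (verts G)" unfolding v using fin by simp
  from o[unfolded orderable_iff[OF fG] v] obtain pos :: "nat \<Rightarrow> nat" and col
    where inj: "inj_on pos (A \<union> B)" and
    c: "\<forall>u\<in>A \<union> B. \<forall>v\<in>A \<union> B. pos u < pos v \<and> {u, v} \<in> edges G \<longrightarrow> \<chi> {u, v} = col u"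
    by (elim exE conjE)
  have col: "\<chi> {u, v} = col u"
    if "u \<in> A \<union> B" "v \<in> A \<union> B" "pos u < pos v" "{u, v} \<in> edges G" for u v
    using c[rule_format, OF that(1,2) conjI[OF that(3,4)]] .
  have "inj_on pos A" using inj_on_subset[OF inj] by simp
  from exists_sorted_enumeration[OF fin(1) this]
  obtain xs where xs: "set xs = A" "distinct xs" "sorted_wrt (\<lambda>x y. pos x < pos y) xs"
    by (elim exE conjE)
  have "length xs = s" using xs AB(4) distinct_card by metis
  moreover have "B \<subseteq> {b \<in> {..<n} - set xs. fits col (\<lambda>a. \<chi> {b, a}) xs}"
  proof
    fix b assume b: "b \<in> B"
    have ed: "{a, b} \<in> edges G" if "a \<in> A" for a using that b e by blast
    have "fits col (\<lambda>a. \<chi> {b, a}) xs"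
    proof (rule fits_of_positions[of pos xs b])
      show "sorted_wrt (\<lambda>x y. pos x < pos y) xs" using xs(3) .
      fix a assume a: "a \<in> set xs"
      show "\<chi> {b, a} = col b" if "pos b < pos a" using col[of b a] ed[of a] a b that xs(1) by (simp add: insert_commute)
      show "\<chi> {b, a} = col a" if "pos a < pos b" using col[of a b] ed[of a] a b that xs(1) by (simp add: insert_commute)
      show "pos a \<noteq> pos b" using inj a b xs(1) AB(3) by (auto dest: inj_onD)
    qed
    then show "b \<in> {b \<in> {..<n} - set xs. fits col (\<lambda>a. \<chi> {b, a}) xs}" using b AB xs(1) by auto
  qed
  then have "t \<le> card {b \<in> {..<n} - set xs. fits col (\<lambda>a. \<chi> {b, a}) xs}"
    unfolding AB(5)[symmetric] by (intro card_mono) auto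
  ultimately show ?rhs using xs AB(1) by blast
next
  assume ?rhs
  then obtain xs \<kappa> where xs: "distinct xs" "length xs = s" "set xs \<subseteq> {..<n}"
    and t: "t \<le> card {b \<in> {..<n} - set xs. fits \<kappa> (\<lambda>a. \<chi> {b, a}) xs}"
    by (elim exE conjE)
  obtain B where B: "B \<subseteq> {b \<in> {..<n} - set xs. fits \<kappa> (\<lambda>a. \<chi> {b, a}) xs}" "card B = t"
    using obtain_subset_with_card_n[OF t] by blast
  have "\<forall>b\<in>B. \<exists>i w. (\<forall>j<i. j < length xs \<longrightarrow> \<chi> {b, xs ! j} = \<kappa> (xs ! j)) \<and>
      (\<forall>j\<ge>i. j < length xs \<longrightarrow> \<chi> {b, xs ! j} = w)"
  proof
    fix b assume "b \<in> B"
    then have "fits \<kappa> (\<lambda>a. \<chi> {b, a}) xs" using B(1) by blast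
    then show "\<exists>i w. (\<forall>j<i. j < length xs \<longrightarrow> \<chi> {b, xs ! j} = \<kappa> (xs ! j)) \<and>
      (\<forall>j\<ge>i. j < length xs \<longrightarrow> \<chi> {b, xs ! j} = w)" by (rule fits_gap)
  qed
  then obtain gap w where gap: "\<And>b j. b \<in> B \<Longrightarrow> j < gap b \<Longrightarrow> j < length xs \<Longrightarrow> \<chi> {b, xs ! j} = \<kappa> (xs ! j)"
    "\<And>b j. b \<in> B \<Longrightarrow> gap b \<le> j \<Longrightarrow> j < length xs \<Longrightarrow> \<chi> {b, xs ! j} = w b"
    by metis
  define G where "G = \<lparr>verts = set xs \<union> B, edges = {{a, b} |a b. a \<in> set xs \<and> b \<in> B}\<rparr>"
  have disj: "set xs \<inter> B = {}" "B \<subseteq> {..<n}" using B by auto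
  have copy: "copy_in (complete_graph n) (complete_bipartite s t) G"
    unfolding copy_complete_bipartite
    using xs disj B(2) distinct_card[OF xs(1)] by (intro exI[of _ "set xs"] exI[of _ B]) (simp add: G_def)
  define ind where "ind a = (THE j. j < length xs \<and> xs ! j = a)" for a
  have ind: "ind a < length xs" "xs ! ind a = a" if "a \<in> set xs" for a
  proof -
    have "\<exists>!i. i < length xs \<and> xs ! i = a" using that distinct_Ex1[OF xs(1)] by metis
    then show "ind a < length xs" "xs ! ind a = a" unfolding ind_def by (rule theI'[THEN conjunct1], rule theI'[THEN conjunct2])
  qed
  \<comment> \<open>Lexicographic by gap; the offset \<open>n\<close> puts \<open>xs ! j\<close> after the vertices of \<open>B\<close> in gap \<open>j\<close>.\<close>
  define pos where "pos v = (if v \<in> B then gap v * Suc n + v else ind v * Suc n + n)" for v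
  define col where "col v = (if v \<in> B then w v else \<kappa> v)" for v
  have fin: "finite (verts G)" unfolding G_def using disj finite_subset by auto
  \<comment> \<open>Quotient and remainder by \<open>Suc n\<close> recover the block and the vertex:
    vertices of \<open>B\<close> leave remainders below \<open>n\<close>, those of \<open>xs\<close>
    leave \<open>n\<close>. Injectivity follows.\<close>
  have div: "pos v div Suc n = (if v \<in> B then gap v else ind v)" "pos v mod Suc n = (if v \<in> B then v else n)"
    if "v \<in> set xs \<union> B" for v
    using that disj(2) unfolding pos_def by (auto simp del: mult_Suc_right)
  have "inj_on pos (verts G)"
  proof (rule inj_onI)
    fix u v assume uv: "u \<in> verts G" "v \<in> verts G" "pos u = pos v"
    then have "(if u \<in> B then gap u else ind u) = (if v \<in> B then gap v else ind v)"
      "(if u \<in> B then u else n) = (if v \<in> B then v else n)"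
      using div[of u] div[of v] by (auto simp: G_def)
    then show "u = v" using uv(1,2) ind disj unfolding G_def by (auto split: if_splits) (metis Un_iff)+
  qed
  moreover have "\<chi> {u, v} = col u"
    if uv: "u \<in> verts G" "v \<in> verts G" "pos u < pos v" "{u, v} \<in> edges G" for u v
  proof -
    obtain a b where ab: "{u, v} = {a, b}" "a \<in> set xs" "b \<in> B" using uv(4) unfolding G_def by auto
    have bn: "b < n" using ab disj by auto
    have aB: "a \<notin> B" using ab disj by auto
    show ?thesis
    proof (cases "u = b")
      case True
      then have v: "v = a" using ab by (auto simp: doubleton_eq_iff)
      have "gap b \<le> ind a"
      proof (rule ccontr)
        assume "\<not> ?thesis"
        then have "Suc (ind a) * Suc n \<le> gap b * Suc n" by (intro mult_le_mono1) simp
        then have "pos a \<le> pos b" unfolding pos_def using aB ab(3) by simp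
        then show False using uv(3) True v by simp
      qed
      then show ?thesis using gap(2)[OF ab(3), of "ind a"] ind[OF ab(2)] True v ab(3) by (simp add: col_def)
    next
      case False
      then have uv': "u = a" "v = b" using ab by (auto simp: doubleton_eq_iff)
      have "ind a < gap b"
      proof (rule ccontr)
        assume "\<not> ?thesis"
        then have "gap b * Suc n \<le> ind a * Suc n" by (intro mult_le_mono1) simp
        then have "pos b \<le> pos a" unfolding pos_def using aB ab(3) bn by simp
        then show False using uv(3) uv' by simp
      qed
      then show ?thesis using gap(1)[OF ab(3), of "ind a"] ind[OF ab(2)] uv' aB
        by (simp add: col_def insert_commute)
    qed
  qed
  ultimately have "orderable G \<chi>" using orderable_iff[OF fin] by blast
  then show ?lhs using copy by blast
qed

lemma rainbow_triangle_iff: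
  "(\<exists>H. copy_in (complete_graph n) (complete_graph 3) H \<and> rainbow H \<chi>) \<longleftrightarrow>
   \<not> gallai (\<lambda>x y. \<chi> {x, y}) {..<n}" (is "?lhs \<longleftrightarrow> ?rhs")
proof -
  have less3: "u < 3 \<longleftrightarrow> u = 0 \<or> u = 1 \<or> u = 2" for u :: nat by linarith
  have e3: "edges (complete_graph 3) = {{0, 1}, {1, 2}, {0, 2}}"
  proof
    show "edges (complete_graph 3) \<subseteq> {{0, 1}, {1, 2}, {0, 2}}"
      unfolding complete_graph_def by (auto simp: less3)
    show "{{0, 1}, {1, 2}, {0, 2}} \<subseteq> edges (complete_graph 3)"
      by (simp add: edges_complete_graph)
  qed
  have v3: "{..<3} = {0, 1, 2 :: nat}" unfolding lessThan_def by (auto simp: less3)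
  show ?thesis
  proof
    assume ?lhs
    then obtain H where copy: "copy_in (complete_graph n) (complete_graph 3) H" and "rainbow H \<chi>"
      by (elim exE conjE)
    then have r: "inj_on \<chi> (edges H)" by (simp only: rainbow_def)
    have sub: "verts H \<subseteq> {..<n}"
      using copy unfolding copy_in_def subgraph_def verts_complete_graph by (elim conjE)
    have "\<exists>f. bij_betw f {0, 1, 2 :: nat} (verts H) \<and> edges H = (\<lambda>e. f ` e) ` {{0, 1}, {1, 2}, {0, 2}}"
      using copy unfolding copy_in_def graph_iso_def verts_complete_graph e3 v3 by (elim conjE)
    then obtain f :: "nat \<Rightarrow> nat" where f: "bij_betw f {0, 1, 2} (verts H)"
      and e': "edges H = (\<lambda>e. f ` e) ` {{0, 1}, {1, 2}, {0, 2}}" by (elim exE conjE)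
    have e: "edges H = {{f 0, f 1}, {f 1, f 2}, {f 0, f 2}}" unfolding e' by simp
    let ?x = "f 0" and ?y = "f 1" and ?z = "f 2"
    have d: "?x \<noteq> ?y" "?y \<noteq> ?z" "?x \<noteq> ?z" using f unfolding bij_betw_def inj_on_def by auto
    have m: "?x \<in> {..<n}" "?y \<in> {..<n}" "?z \<in> {..<n}" using f sub unfolding bij_betw_def by auto
    have "\<chi> {?x, ?y} \<noteq> \<chi> {?y, ?z}" "\<chi> {?y, ?z} \<noteq> \<chi> {?x, ?z}" "\<chi> {?x, ?y} \<noteq> \<chi> {?x, ?z}"
      using inj_onD[OF r, of "{?x, ?y}" "{?y, ?z}"] inj_onD[OF r, of "{?y, ?z}" "{?x, ?z}"]
        inj_onD[OF r, of "{?x, ?y}" "{?x, ?z}"] d by (auto simp: e doubleton_eq_iff)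
    then show ?rhs unfolding gallai_def using d m by blast
  next
    assume ?rhs
    then obtain x y z where m: "x < n" "y < n" "z < n" and d: "x \<noteq> y" "y \<noteq> z" "x \<noteq> z"
      and c: "\<chi> {x, y} \<noteq> \<chi> {y, z}" "\<chi> {y, z} \<noteq> \<chi> {x, z}" "\<chi> {x, y} \<noteq> \<chi> {x, z}"
      unfolding gallai_def by auto
    define H :: "nat graph" where "H = \<lparr>verts = {x, y, z}, edges = {{x, y}, {y, z}, {x, z}}\<rparr>"
    define f where "f i = (if i = 0 then x else if i = 1 then y else z)" for i :: nat
    have "bij_betw f {0, 1, 2} {x, y, z}"
      unfolding bij_betw_def inj_on_def f_def using d by auto
    moreover have "edges H = (\<lambda>e. f ` e) ` {{0, 1}, {1, 2}, {0, 2}}"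
      unfolding H_def f_def by (simp add: insert_commute)
    moreover have "edges H \<subseteq> edges (complete_graph n)"
      unfolding H_def using m d by (auto simp: edges_complete_graph)
    ultimately have "copy_in (complete_graph n) (complete_graph 3) H"
      unfolding copy_in_def subgraph_def graph_iso_def verts_complete_graph e3 v3
      using m by (auto simp: H_def)
    moreover have "rainbow H \<chi>" unfolding rainbow_def H_def using c by (auto simp: inj_on_def)
    ultimately show ?lhs by blast
  qed
qed

section \<open>The Ramsey numbers\<close>

lemma two_coloured_gallai:
  assumes "\<chi> ` edges (complete_graph n) \<subseteq> {0, 1 :: nat}"
  shows "gallai (\<lambda>x y. \<chi> {x, y}) {..<n}"
proof -
  have "\<chi> {x, y} = 0 \<or> \<chi> {x, y} = 1" if "x < n" "y < n" "x \<noteq> y" for x y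
    using assms that edges_complete_graph[of x y n] by blast
  then show ?thesis unfolding gallai_def by (metis lessThan_iff)
qed

text \<open>One bound of each kind settles both numbers. A two-coloured graph has no rainbow
  triangle, so \<open>\<chi>0\<close> refutes both properties, and restricting it refutes every
  smaller \<open>n\<close>; conversely the upper hypothesis covers all two-colourings.\<close>

lemma ramsey_numbers_eq:
  assumes lower: "\<chi>0 ` edges (complete_graph q) \<subseteq> {0, 1}"
      "\<And>n. n \<le> q \<Longrightarrow> \<not> (\<exists>G'. copy_in (complete_graph n) G G' \<and> orderable G' (\<chi>0 :: nat set \<Rightarrow> nat))"
    and upper: "\<And>\<chi> :: nat set \<Rightarrow> nat. gallai (\<lambda>x y. \<chi> {x, y}) {..<Suc q} \<Longrightarrow>
      \<exists>G'. copy_in (complete_graph (Suc q)) G G' \<and> orderable G' \<chi>"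
  shows "r2' G = Suc q" "CR G (complete_graph 3) = Suc q"
proof -
  have two: "\<chi>0 ` edges (complete_graph n) \<subseteq> {0, 1}" if "n \<le> q" for n
  proof -
    have "edges (complete_graph n) \<subseteq> edges (complete_graph q)"
    proof
      fix e assume "e \<in> edges (complete_graph n)"
      then obtain u v where "e = {u, v}" "u < n" "v < n" "u \<noteq> v" unfolding complete_graph_def by auto
      then show "e \<in> edges (complete_graph q)" using that by (simp add: edges_complete_graph)
    qed
    from order_trans[OF image_mono[OF this] lower(1)] show ?thesis .
  qed
  show "r2' G = Suc q"
    unfolding r2'_def
  proof (rule Least_equality)
    show "\<forall>\<chi> :: nat set \<Rightarrow> nat. \<chi> ` edges (complete_graph (Suc q)) \<subseteq> {0, 1} \<longrightarrow>
       (\<exists>G'. copy_in (complete_graph (Suc q)) G G' \<and> orderable G' \<chi>)"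
      using upper two_coloured_gallai by simp
    fix n
    assume n: "\<forall>\<chi> :: nat set \<Rightarrow> nat. \<chi> ` edges (complete_graph n) \<subseteq> {0, 1} \<longrightarrow>
       (\<exists>G'. copy_in (complete_graph n) G G' \<and> orderable G' \<chi>)"
    show "Suc q \<le> n"
    proof (rule ccontr)
      assume "\<not> ?thesis"
      then have "n \<le> q" by simp
      then show False using n[rule_format, OF two] lower(2) by simp
    qed
  qed
  show "CR G (complete_graph 3) = Suc q"
    unfolding CR_def rainbow_triangle_iff
  proof (rule Least_equality)
    show "\<forall>\<chi> :: nat set \<Rightarrow> nat. (\<exists>G'. copy_in (complete_graph (Suc q)) G G' \<and> orderable G' \<chi>) \<or>
       \<not> gallai (\<lambda>x y. \<chi> {x, y}) {..<Suc q}"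
      using upper by blast
    fix n
    assume n: "\<forall>\<chi> :: nat set \<Rightarrow> nat. (\<exists>G'. copy_in (complete_graph n) G G' \<and> orderable G' \<chi>) \<or>
       \<not> gallai (\<lambda>x y. \<chi> {x, y}) {..<n}"
    show "Suc q \<le> n"
    proof (rule ccontr)
      assume "\<not> ?thesis"
      then have "n \<le> q" by simp
      then show False using n[rule_format, of \<chi>0] lower(2) two_coloured_gallai[OF two] by simp
    qed
  qed
qed

lemma card_fits:
  assumes "distinct xs" "set xs \<subseteq> {..<n}"
  shows "card {b \<in> {..<n} - set xs. fits \<kappa> (c b) xs} + card (bad c {..<n} \<kappa> xs) + length xs = n"
proof -
  have "card {b \<in> {..<n} - set xs. fits \<kappa> (c b) xs} + card (bad c {..<n} \<kappa> xs)
      = card ({b \<in> {..<n} - set xs. fits \<kappa> (c b) xs} \<union> bad c {..<n} \<kappa> xs)"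
    by (intro card_Un_disjoint[symmetric]) (auto simp: bad_def)
  also have "{b \<in> {..<n} - set xs. fits \<kappa> (c b) xs} \<union> bad c {..<n} \<kappa> xs = {..<n} - set xs"
    by (auto simp: bad_def)
  also have "card \<dots> = n - length xs"
    using assms by (simp add: card_Diff_subset distinct_card)
  finally have "card {b \<in> {..<n} - set xs. fits \<kappa> (c b) xs} + card (bad c {..<n} \<kappa> xs) = n - length xs" .
  moreover have "length xs \<le> n"
    using card_mono[OF _ assms(2)] assms(1) by (simp add: distinct_card)
  ultimately show ?thesis by linarith
qed

lemma orderable_copy_of_small_bad:
  fixes \<chi> :: "nat set \<Rightarrow> 'c"
  assumes "distinct xs" "set xs \<subseteq> {..<n}" "card (bad (\<lambda>x y. \<chi> {x, y}) {..<n} \<kappa> xs) + length xs + t \<le> n"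
  shows "\<exists>G. copy_in (complete_graph n) (complete_bipartite (length xs) t) G \<and> orderable G \<chi>"
proof -
  have "t \<le> card {b \<in> {..<n} - set xs. fits \<kappa> (\<lambda>a. \<chi> {b, a}) xs}"
    using card_fits[OF assms(1,2), of \<kappa> "\<lambda>x y. \<chi> {x, y}"] assms(3) by linarith
  then show ?thesis unfolding orderable_copy_iff using assms(1,2)
    by (intro exI[of _ xs] exI[of _ \<kappa>] conjI refl)
qed

lemma no_orderable_copy_of_large_bad:
  fixes \<chi> :: "nat set \<Rightarrow> 'c"
  assumes large: "\<And>xs \<kappa>. distinct xs \<Longrightarrow> length xs = r \<Longrightarrow> set xs \<subseteq> {..<q} \<Longrightarrow>
      q < card (bad (\<lambda>x y. \<chi> {x, y}) {..<q} \<kappa> xs) + r + t"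
    and n: "n \<le> q"
  shows "\<not> (\<exists>G. copy_in (complete_graph n) (complete_bipartite r t) G \<and> orderable G \<chi>)"
  unfolding orderable_copy_iff
proof
  assume "\<exists>xs \<kappa>. distinct xs \<and> length xs = r \<and> set xs \<subseteq> {..<n} \<and>
      t \<le> card {b \<in> {..<n} - set xs. fits \<kappa> (\<lambda>a. \<chi> {b, a}) xs}"
  then obtain xs \<kappa> where xs: "distinct xs" "length xs = r" "set xs \<subseteq> {..<n}"
    and t: "t \<le> card {b \<in> {..<n} - set xs. fits \<kappa> (\<lambda>a. \<chi> {b, a}) xs}" by (elim exE conjE)
  have xq: "set xs \<subseteq> {..<q}" using xs(3) n by auto
  have "card {b \<in> {..<n} - set xs. fits \<kappa> (\<lambda>a. \<chi> {b, a}) xs} \<le>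
      card {b \<in> {..<q} - set xs. fits \<kappa> (\<lambda>a. \<chi> {b, a}) xs}"
    using n by (intro card_mono) auto
  then show False
    using t large[OF xs(1,2) xq, of \<kappa>] card_fits[OF xs(1) xq, of \<kappa> "\<lambda>x y. \<chi> {x, y}"] xs(2) by linarith
qed

text \<open>Not both deletions can hit, so the disjoint sets keep at least \<open>2 * s - 1\<close>
  elements together. For triples, \<open>u\<close> and \<open>v\<close> are small-side vertices that
  may lie in the pattern sets.\<close>

lemma card_two_deletions:
  fixes s :: nat
  assumes "card A = s" "card B = s" "finite A" "finite B" "A \<inter> B = {}" "\<not> (u \<in> A \<and> v \<in> B)"
    "A - {u} \<subseteq> Z" "B - {v} \<subseteq> Z" "finite Z"
  shows "2 * s \<le> card Z + 1"
proof -
  have "card (A - {u}) + card (B - {v}) = card ((A - {u}) \<union> (B - {v}))"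
    using assms(3-5) by (intro card_Un_disjoint[symmetric]) auto
  also have "\<dots> \<le> card Z" using assms(7-9) by (intro card_mono) auto
  finally have *: "card (A - {u}) + card (B - {v}) \<le> card Z" .
  show ?thesis
  proof (cases "u \<in> A")
    case True
    then have "card (B - {v}) = s" using assms(2,6) by simp
    then show ?thesis using * True assms(1,3) by simp
  next
    case False
    then have "card (A - {u}) = s" using assms(1) by simp
    moreover have "s \<le> card (B - {v}) + 1" using assms(2,4) by (cases "v \<in> B") auto
    ultimately show ?thesis using * by simp
  qed
qed

section \<open>Lower bound: many bad vertices in the Paley colouring\<close>

locale paley_colouring =
  fixes s :: nat and R :: "nat \<Rightarrow> nat \<Rightarrow> bool" and \<chi> :: "nat set \<Rightarrow> nat"
  assumes R_sym: "R x y = R y x"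
    and R_card: "x < 4 * s + 1 \<Longrightarrow> y < 4 * s + 1 \<Longrightarrow> x \<noteq> y \<Longrightarrow>
      card {b \<in> {..<4 * s + 1} - {x, y}. R b x \<noteq> a \<and> R b y = a} = s"
    and \<chi>: "\<chi> {x, y} = (if R x y then 0 else 1)"
begin

abbreviation "q \<equiv> 4 * s + 1"

definition D :: "bool \<Rightarrow> nat \<Rightarrow> nat \<Rightarrow> nat set" where
  "D a x y = {b \<in> {..<q} - {x, y}. R b x \<noteq> a \<and> R b y = a}"

lemma card_D: "x < q \<Longrightarrow> y < q \<Longrightarrow> x \<noteq> y \<Longrightarrow> card (D a x y) = s"
  unfolding D_def using R_card by simp

lemma finite_D: "finite (D a x y)"
  unfolding D_def by simp

lemma card_bad_pair:
  assumes "x < q" "y < q" "x \<noteq> y"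
  shows "s \<le> card (bad (\<lambda>x y. \<chi> {x, y}) {..<q} \<kappa> [x, y])"
proof -
  \<comment> \<open>A value of \<open>\<kappa> x\<close> other than 0 and 1 is treated like 1: the
    edge to \<open>x\<close> then has colour 0, which still differs from
    \<open>\<kappa> x\<close>.\<close>
  have "D (\<kappa> x = 0) x y \<subseteq> bad (\<lambda>x y. \<chi> {x, y}) {..<q} \<kappa> [x, y]"
    unfolding D_def bad_def by (auto simp: \<chi> split: if_splits)
  then have "card (D (\<kappa> x = 0) x y) \<le> card (bad (\<lambda>x y. \<chi> {x, y}) {..<q} \<kappa> [x, y])"
    by (intro card_mono) (auto simp: bad_def)
  then show ?thesis using card_D assms by simp
qed

lemma card_bad_triple:
  assumes xyz: "x < q" "y < q" "z < q" "x \<noteq> y" "y \<noteq> z" "x \<noteq> z"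
  shows "2 * s \<le> card (bad (\<lambda>x y. \<chi> {x, y}) {..<q} \<kappa> [x, y, z]) + 1" (is "_ \<le> card ?Z + 1")
proof -
  let ?a = "\<kappa> x = 0" and ?b = "\<kappa> y = 0"
  have fZ: "finite ?Z" unfolding bad_def by simp
  show ?thesis
  proof (cases "?a = ?b")
    \<comment> \<open>The edge to \<open>y\<close> separates the two sets. Both deletions together
      would demand opposite values of \<open>R\<close> on the pair \<open>x\<close>,
      \<open>z\<close>.\<close>
    case True
    show ?thesis
    proof (rule card_two_deletions[where A = "D ?a x y" and B = "D ?a y z" and u = z and v = x])
      show "D ?a x y \<inter> D ?a y z = {}" unfolding D_def by auto
      show "\<not> (z \<in> D ?a x y \<and> x \<in> D ?a y z)" unfolding D_def using R_sym by auto
      show "D ?a x y - {z} \<subseteq> ?Z" unfolding D_def bad_def by (auto simp: \<chi> split: if_splits)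
      show "D ?a y z - {x} \<subseteq> ?Z" unfolding D_def bad_def True by (auto simp: \<chi> split: if_splits)
    qed (use xyz fZ card_D finite_D in auto)
  next
    \<comment> \<open>Now \<open>D ?a x y\<close> and \<open>D ?b y z\<close> could overlap, so both
      patterns are made to end at \<open>z\<close>, where the required values differ. Both deletions
      together would make \<open>R x y\<close> differ from \<open>?a\<close> and from
      \<open>?b\<close>.\<close>
    case False
    show ?thesis
    proof (rule card_two_deletions[where A = "D ?a x z" and B = "D ?b y z" and u = y and v = x])
      show "D ?a x z \<inter> D ?b y z = {}" unfolding D_def using False by auto
      show "\<not> (y \<in> D ?a x z \<and> x \<in> D ?b y z)" unfolding D_def using R_sym False by auto
      show "D ?a x z - {y} \<subseteq> ?Z" unfolding D_def bad_def by (auto simp: \<chi> split: if_splits)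
      show "D ?b y z - {x} \<subseteq> ?Z" unfolding D_def bad_def by (auto simp: \<chi> split: if_splits)
    qed (use xyz fZ card_D finite_D in auto)
  qed
qed

lemma no_orderable_pair:
  assumes "n \<le> q"
  shows "\<not> (\<exists>G. copy_in (complete_graph n) (complete_bipartite 2 (3 * s)) G \<and> orderable G \<chi>)"
  using _ assms
proof (rule no_orderable_copy_of_large_bad)
  fix xs and \<kappa> :: "nat \<Rightarrow> nat"
  assume xs: "distinct xs" "length xs = 2" "set xs \<subseteq> {..<q}"
  then obtain x y where "xs = [x, y]" by (auto simp: numeral_2_eq_2 length_Suc_conv)
  then show "q < card (bad (\<lambda>x y. \<chi> {x, y}) {..<q} \<kappa> xs) + 2 + 3 * s"
    using card_bad_pair[of x y \<kappa>] xs by simp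
qed

lemma no_orderable_triple:
  assumes "n \<le> q"
  shows "\<not> (\<exists>G. copy_in (complete_graph n) (complete_bipartite 3 (2 * s)) G \<and> orderable G \<chi>)"
  using _ assms
proof (rule no_orderable_copy_of_large_bad)
  fix xs and \<kappa> :: "nat \<Rightarrow> nat"
  assume xs: "distinct xs" "length xs = 3" "set xs \<subseteq> {..<q}"
  then obtain x y z where "xs = [x, y, z]" by (auto simp: numeral_3_eq_3 length_Suc_conv)
  then show "q < card (bad (\<lambda>x y. \<chi> {x, y}) {..<q} \<kappa> xs) + 3 + 2 * s"
    using card_bad_triple[of x y z \<kappa>] xs by simp
qed

lemma image_edges: "\<chi> ` edges (complete_graph n) \<subseteq> {0, 1}"
  unfolding complete_graph_def by (auto simp: \<chi>)

end

lemma exists_paley_colouring: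
  assumes "primepow (4 * s + 1)"
  shows "\<exists>R \<chi>. paley_colouring s R \<chi>"
proof -
  obtain R :: "nat \<Rightarrow> nat \<Rightarrow> bool" where R: "\<And>x y. R x y = R y x"
    "\<And>x y a. x < 4 * s + 1 \<Longrightarrow> y < 4 * s + 1 \<Longrightarrow> x \<noteq> y \<Longrightarrow>
      card {b \<in> {..<4 * s + 1} - {x, y}. R b x \<noteq> a \<and> R b y = a} = s"
    using paley_colouring_exists[OF assms] by blast
  \<comment> \<open>\<open>Min\<close> and \<open>Max\<close> read the endpoints off the unordered
    edge; symmetry of \<open>R\<close> makes their order irrelevant.\<close>
  have "paley_colouring s R (\<lambda>e. if R (Min e) (Max e) then 0 else 1)"
  proof
    fix x y
    have "R (Min {x, y}) (Max {x, y}) = R x y"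
      using R(1) by (cases "x \<le> y") (auto simp: min_def max_def)
    then show "(if R (Min {x, y}) (Max {x, y}) then 0 else 1) = (if R x y then 0 else (1 :: nat))"
      by simp
  qed (use R in auto)
  then show ?thesis by blast
qed

section \<open>Upper bound and the resulting values\<close>

lemma symmetric_colouring_edges: "symmetric_colouring (\<lambda>x y. \<chi> {x, y})"
  by unfold_locales (simp add: insert_commute)

lemma orderable_pair:
  fixes \<chi> :: "nat set \<Rightarrow> 'c"
  assumes "gallai (\<lambda>x y. \<chi> {x, y}) {..<Suc (4 * s + 1)}"
  shows "\<exists>G. copy_in (complete_graph (Suc (4 * s + 1))) (complete_bipartite 2 (3 * s)) G \<and> orderable G \<chi>"
proof -
  let ?n = "Suc (4 * s + 1)"
  obtain x y k where xy: "x \<in> {..<?n}" "y \<in> {..<?n}" "x \<noteq> y"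
    "4 * card (bad (\<lambda>x y. \<chi> {x, y}) {..<?n} (\<lambda>_. k) [x, y]) < card {..<?n}"
    using symmetric_colouring.gallai_pair[OF symmetric_colouring_edges finite_lessThan assms] by auto
  \<comment> \<open>Integrality turns \<open>4 * card < 4 * s + 2\<close> into at most
    \<open>s\<close> bad vertices, and \<open>s + 2 + 3 * s\<close> is exactly the number of
    vertices.\<close>
  from xy(4) have "card (bad (\<lambda>x y. \<chi> {x, y}) {..<?n} (\<lambda>_. k) [x, y]) \<le> s"
    unfolding card_lessThan by linarith
  then show ?thesis
    using orderable_copy_of_small_bad[of "[x, y]" ?n \<chi> "\<lambda>_. k" "3 * s"] xy(1-3)
    by (simp add: numeral_2_eq_2)
qed

lemma orderable_triple:
  fixes \<chi> :: "nat set \<Rightarrow> 'c"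
  assumes "gallai (\<lambda>x y. \<chi> {x, y}) {..<Suc (4 * s + 1)}" "s > 0"
  shows "\<exists>G. copy_in (complete_graph (Suc (4 * s + 1))) (complete_bipartite 3 (2 * s)) G \<and> orderable G \<chi>"
proof -
  let ?n = "Suc (4 * s + 1)"
  have "3 \<le> card {..<?n}" using assms(2) by simp
  from symmetric_colouring.gallai_triple[OF symmetric_colouring_edges finite_lessThan assms(1) this]
  obtain x y z k where xy: "x \<in> {..<?n}" "y \<in> {..<?n}" "z \<in> {..<?n}" "x \<noteq> y" "y \<noteq> z" "x \<noteq> z"
    "2 * card (bad (\<lambda>x y. \<chi> {x, y}) {..<?n} (\<lambda>_. k) [x, y, z]) + 3 \<le> card {..<?n}"
    by (elim bexE exE conjE)
  \<comment> \<open>By parity \<open>2 * card + 3 \<le> 4 * s + 2\<close> leaves at most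
    \<open>2 * s - 1\<close> bad vertices, and \<open>(2 * s - 1) + 3 + 2 * s\<close> is exactly the
    number of vertices.\<close>
  from xy(7) assms(2) have "card (bad (\<lambda>x y. \<chi> {x, y}) {..<?n} (\<lambda>_. k) [x, y, z]) + 1 \<le> 2 * s"
    unfolding card_lessThan by linarith
  then show ?thesis
    using orderable_copy_of_small_bad[of "[x, y, z]" ?n \<chi> "\<lambda>_. k" "2 * s"] xy(1-6)
    by (simp add: numeral_3_eq_3)
qed

theorem corollary1p10:
  fixes t :: nat
  assumes "t > 0"
  shows "([t = 0] (mod 3) \<and> primepow (4 * t div 3 + 1) \<longrightarrow>
           r2' (complete_bipartite 2 t) = CR (complete_bipartite 2 t) (complete_graph 3) \<and>
           CR (complete_bipartite 2 t) (complete_graph 3) = 4 * t div 3 + 2) \<and>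
         (even t \<and> primepow (2 * t + 1) \<longrightarrow>
           r2' (complete_bipartite 3 t) = CR (complete_bipartite 3 t) (complete_graph 3) \<and>
           CR (complete_bipartite 3 t) (complete_graph 3) = 2 * t + 2)"
proof (intro conjI impI; elim conjE)
  assume "[t = 0] (mod 3)" and pp: "primepow (4 * t div 3 + 1)"
  then obtain s where s: "t = 3 * s" by (auto simp: cong_0_iff)
  have q: "4 * t div 3 = 4 * s" using s by simp
  obtain R \<chi> where "paley_colouring s R \<chi>" using exists_paley_colouring pp q by metis
  then interpret paley_colouring s R \<chi> .
  from ramsey_numbers_eq[OF image_edges no_orderable_pair orderable_pair]
  have "r2' (complete_bipartite 2 t) = Suc (4 * s + 1)"
    "CR (complete_bipartite 2 t) (complete_graph 3) = Suc (4 * s + 1)"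
    unfolding s by simp_all
  then show "r2' (complete_bipartite 2 t) = CR (complete_bipartite 2 t) (complete_graph 3)"
    "CR (complete_bipartite 2 t) (complete_graph 3) = 4 * t div 3 + 2"
    unfolding q by simp_all
next
  assume "even t" and pp: "primepow (2 * t + 1)"
  then obtain s where s: "t = 2 * s" by auto
  have q: "2 * t = 4 * s" using s by simp
  have pos: "s > 0" using assms s by simp
  obtain R \<chi> where "paley_colouring s R \<chi>" using exists_paley_colouring pp q by metis
  then interpret paley_colouring s R \<chi> .
  from ramsey_numbers_eq[OF image_edges no_orderable_triple orderable_triple[OF _ pos]]
  have "r2' (complete_bipartite 3 t) = Suc (4 * s + 1)"
    "CR (complete_bipartite 3 t) (complete_graph 3) = Suc (4 * s + 1)"
    unfolding s by simp_all
  then show "r2' (complete_bipartite 3 t) = CR (complete_bipartite 3 t) (complete_graph 3)"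
    "CR (complete_bipartite 3 t) (complete_graph 3) = 2 * t + 2"
    unfolding q by simp_all
qed

end
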